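(* Let $\alpha\in(0,1)$ be a fixed real number and let $g\ge 1$ be a fixed integer. Let $(A_n)$ be a sequence of real numbers such that, for all sufficiently large $n$, the quantity $$p=p_n=\sqrt{\frac{\frac{2}{\alpha}\log n+(g-2)\frac{2}{\alpha}\log\log n+A_n}{n}}$$ is well defined and lies in $[0,1]$. For each such $n$, let $\mathcal{A}\subseteq\{0\}\cup[n]$ be the random set obtained by choosing each element of $\{0\}\cup[n]$ to be in $\mathcal{A}$ independently with probability $p_n$. Then, as $n\to\infty$, $$\mathbb{P}(\mathcal{A}\text{ is a truncated }(\alpha,2,g)\text{ additive basis})\to\begin{cases}0 & \text{if } A_n\to-\infty,\\ 1 & \text{if } A_n\to\infty,\\ \exp\left\{-\dfrac{2\alpha}{(g-1)!}\,e^{-A\alpha/2}\right\} & \text{if } A_n\to A\in\mathbb{R}.\end{cases}$$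
   Context: Here $[n]=\{1,2,\ldots,n\}$ and $\log$ is the natural logarithm. A representation of an integer $j$ as a $2$-sum of elements of a set $\mathcal{A}\subseteq\{0\}\cup[n]$ is an unordered pair (multiset) $\{a,b\}$ with $a,b\in\mathcal{A}$, $a=b$ allowed, and $a+b=j$; equivalently, a pair $(a,b)\in\mathcal{A}^2$ with $a\le b$ and $a+b=j$. The set $\mathcal{A}\subseteq\{0\}\cup[n]$ is called a truncated $(\alpha,2,g)$ additive basis if every integer $j\in[\alpha n,(2-\alpha)n]$ can be represented as a $2$-sum of elements of $\mathcal{A}$ in at least $g$ ways, i.e., has at least $g$ distinct such representations. *)

theory Defs
  imports "HOL-Probability.Probability"
begin

text \<open>Representations of \<open>j\<close> as a 2-sum: an unordered pair with repetition allowed is encoded as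
  the ordered pair \<open>(a, b)\<close> with \<open>a \<le> b\<close>. This set is finite for every \<open>S\<close>.\<close>

definition two_sum_reps :: "nat set \<Rightarrow> nat \<Rightarrow> (nat \<times> nat) set" where
  "two_sum_reps S j = {(a, b). a \<in> S \<and> b \<in> S \<and> a \<le> b \<and> a + b = j}"

text \<open>For \<open>\<alpha> \<ge> 0\<close>, which is the only case used, every integer in the interval is nonnegative,
  so \<open>j\<close> may range over the natural numbers.\<close>

definition truncated_additive_basis :: "real \<Rightarrow> nat \<Rightarrow> nat \<Rightarrow> nat set \<Rightarrow> bool" where
  "truncated_additive_basis \<alpha> g n S \<longleftrightarrow>
     S \<subseteq> {0..n} \<and>
     (\<forall>j::nat. \<alpha> * real n \<le> real j \<and> real j \<le> (2 - \<alpha>) * real n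
        \<longrightarrow> card (two_sum_reps S j) \<ge> g)"

text \<open>The library's \<open>bernoulli_pmf p\<close> truncates \<open>p\<close> to the unit interval, so this is the intended
  distribution only for \<open>0 \<le> p \<le> 1\<close>.\<close>

definition random_subset :: "nat \<Rightarrow> real \<Rightarrow> nat set pmf" where
  "random_subset n p =
     map_pmf (\<lambda>f. {x \<in> {0..n}. f x}) (Pi_pmf {0..n} False (\<lambda>_. bernoulli_pmf p))"

definition threshold_radicand :: "real \<Rightarrow> nat \<Rightarrow> (nat \<Rightarrow> real) \<Rightarrow> nat \<Rightarrow> real" where
  "threshold_radicand \<alpha> g A n =
     (2 / \<alpha> * ln (real n) + (real g - 2) * (2 / \<alpha>) * ln (ln (real n)) + A n) / real n"

text \<open>Since \<open>sqrt\<close> is odd in the library, nonnegativity of the radicand has to be required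
  separately wherever this is to be the real square root of the informal definition.\<close>

definition threshold_prob :: "real \<Rightarrow> nat \<Rightarrow> (nat \<Rightarrow> real) \<Rightarrow> nat \<Rightarrow> real" where
  "threshold_prob \<alpha> g A n = sqrt (threshold_radicand \<alpha> g A n)"

definition basis_prob :: "real \<Rightarrow> nat \<Rightarrow> (nat \<Rightarrow> real) \<Rightarrow> nat \<Rightarrow> real" where
  "basis_prob \<alpha> g A n =
     measure_pmf.prob (random_subset n (threshold_prob \<alpha> g A n))
       {S. truncated_additive_basis \<alpha> g n S}"

end

theory Submission
  imports Defs "HOL-Real_Asymp.Real_Asymp"
begin

text \<open>
  Fix first the sequence \<open>A\<close> to be a constant \<open>K\<close>. The representations of \<open>j\<close> by two distinct
  elements correspond to pairwise disjoint pairs, so their number is binomial with parameters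
  \<open>N\<close> and \<open>p\<^sup>2\<close>, where \<open>N\<close> is about half the distance of \<open>j\<close> from the nearer end of the interval
  from \<open>0\<close> to \<open>2 n\<close>. Only the \<open>j\<close> close to \<open>\<alpha> n\<close> and, by symmetry, to \<open>(2 - \<alpha>) n\<close> contribute to the
  expected number of \<open>j\<close> that are deficient, that is, have fewer than \<open>g\<close> such representations. Summing
  binomial tails over \<open>N\<close> telescopes, which gives the limit
  \<open>2 \<alpha> / (g - 1)! * exp (- K \<alpha> / 2)\<close> of this expectation (lemma \<open>expected_bad_tendsto\<close>).

  What remains is that the events that different \<open>j\<close> are not deficient behave as if they were
  independent. These events are increasing, so by Harris' inequality the probability
  that all of them occur is at least the product of their probabilities, and Newman's argument bounds
  the excess by the sum of the pairwise covariances (lemma \<open>mean_all_near_prod\<close>). A covariance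
  is bounded by exposing the elements of \<open>{0..n}\<close> one at a time: element \<open>k\<close> influences both
  \<open>i\<close> and \<open>j\<close> only if \<open>i - k\<close> and \<open>j - k\<close> are chosen, which together with the variance of the
  choice of \<open>k\<close> costs \<open>p\<^sup>3\<close>, while the numbers of the other representations of \<open>i\<close> and of \<open>j\<close>
  have to stay below \<open>g\<close>. A Janson-type estimate for graphs of maximum degree two
  (lemma \<open>mean_power_edges_inside_le\<close>)
  shows that the latter has probability at most about \<open>n\<^sup>-\<^sup>2\<close>, up to an arbitrarily small power of
  \<open>n\<close>. Since \<open>p\<close> is of order \<open>sqrt (ln n / n)\<close>, the roughly \<open>n\<^sup>2\<close> covariances add up to at most
  \<open>n\<^sup>2 * n * p\<^sup>3 * n\<^sup>-\<^sup>2\<close> times a small power of \<open>n\<close>, which vanishes. Representations \<open>j = 2 a\<close> change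
  the probability by at most \<open>p\<close> times the expected number of deficient \<open>j\<close>.

  Finally, being a basis is an increasing event and \<open>p\<close> increases with \<open>A\<close>. Each of the three
  limits for a general sequence \<open>A\<close> follows by comparison with constant sequences.
\<close>

section \<open>Means over random subsets\<close>

text \<open>The expectation of \<open>f\<close> over a random subset of \<open>V\<close> containing each element independently with
  probability \<open>p\<close>. Being a finite sum, it is linear without integrability conditions, and it obeys
  the recursion \<open>subset_mean_insert\<close>, on which the inductions over \<open>V\<close> rest.\<close>

definition subset_mean :: "'a set \<Rightarrow> real \<Rightarrow> ('a set \<Rightarrow> real) \<Rightarrow> real" where
  "subset_mean V p f = (\<Sum>S\<in>Pow V. p ^ card S * (1 - p) ^ card (V - S) * f S)"

lemma subset_mean_cong:
  "(\<And>S. S \<subseteq> V \<Longrightarrow> f S = g S) \<Longrightarrow> subset_mean V p f = subset_mean V p g"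
  unfolding subset_mean_def by (intro sum.cong) auto

lemma subset_mean_add: "subset_mean V p (\<lambda>S. f S + g S) = subset_mean V p f + subset_mean V p g"
  by (simp add: subset_mean_def sum.distrib algebra_simps)

lemma subset_mean_diff: "subset_mean V p (\<lambda>S. f S - g S) = subset_mean V p f - subset_mean V p g"
  by (simp add: subset_mean_def sum_subtractf algebra_simps)

lemma subset_mean_cmult: "subset_mean V p (\<lambda>S. c * f S) = c * subset_mean V p f"
  by (simp add: subset_mean_def sum_distrib_left algebra_simps)

lemma subset_mean_sum: "subset_mean V p (\<lambda>S. \<Sum>i\<in>I. f i S) = (\<Sum>i\<in>I. subset_mean V p (f i))"
  unfolding subset_mean_def sum_distrib_left by (rule sum.swap)

lemma subset_mean_mono:
  assumes "0 \<le> p" "p \<le> 1" "\<And>S. S \<subseteq> V \<Longrightarrow> f S \<le> g S"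
  shows "subset_mean V p f \<le> subset_mean V p g"
  unfolding subset_mean_def using assms by (intro sum_mono mult_left_mono) auto

lemma subset_mean_insert:
  assumes "finite V" "k \<notin> V"
  shows "subset_mean (insert k V) p f =
    (1 - p) * subset_mean V p f + p * subset_mean V p (\<lambda>S. f (insert k S))"
proof -
  let ?w = "\<lambda>S. p ^ card S * (1 - p) ^ card (insert k V - S) * f S"
  have "subset_mean (insert k V) p f = (\<Sum>S\<in>Pow V. ?w S) + (\<Sum>S\<in>insert k ` Pow V. ?w S)"
    unfolding subset_mean_def Pow_insert using assms by (intro sum.union_disjoint) auto
  also have "(\<Sum>S\<in>insert k ` Pow V. ?w S) = (\<Sum>S\<in>Pow V. ?w (insert k S))"
    using assms by (intro sum.reindex_cong[OF _ refl]) (auto simp: inj_on_def)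
  also have "\<dots> = p * subset_mean V p (\<lambda>S. f (insert k S))"
    unfolding subset_mean_def sum_distrib_left
  proof (intro sum.cong refl)
    fix S assume "S \<in> Pow V"
    then have "finite S" "k \<notin> S" using assms finite_subset by auto
    moreover have "insert k V - insert k S = V - S" using assms by auto
    ultimately show "?w (insert k S) = p * (p ^ card S * (1 - p) ^ card (V - S) * f (insert k S))"
      by simp
  qed
  also have "(\<Sum>S\<in>Pow V. ?w S) = (1 - p) * subset_mean V p f"
    unfolding subset_mean_def sum_distrib_left
  proof (intro sum.cong refl)
    fix S assume "S \<in> Pow V"
    then have "insert k V - S = insert k (V - S)" using assms by auto
    then show "?w S = (1 - p) * (p ^ card S * (1 - p) ^ card (V - S) * f S)"
      using assms by simp
  qed
  finally show ?thesis .
qed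

lemma subset_mean_const: "finite V \<Longrightarrow> subset_mean V p (\<lambda>_. c) = c"
proof (induction V rule: finite_induct)
  case empty
  show ?case by (simp add: subset_mean_def)
next
  case (insert k V)
  then show ?case by (simp add: subset_mean_insert algebra_simps)
qed

lemma subset_mean_split:
  assumes "finite V" "k \<in> V"
  shows "subset_mean V p f =
    (1 - p) * subset_mean V p (\<lambda>S. f (S - {k})) + p * subset_mean V p (\<lambda>S. f (insert k S))"
proof -
  define W where "W = V - {k}"
  have W: "V = insert k W" "finite W" "k \<notin> W" using assms by (auto simp: W_def)
  have "subset_mean W p (\<lambda>S. f (S - {k})) = subset_mean W p f"
    using W by (intro subset_mean_cong arg_cong[of _ _ f]) auto
  moreover have "subset_mean W p (\<lambda>S. f (insert k S - {k})) = subset_mean W p f"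
    using W by (intro subset_mean_cong arg_cong[of _ _ f]) auto
  ultimately show ?thesis
    by (simp add: W subset_mean_insert algebra_simps)
qed

lemma subset_mean_member:
  assumes "finite V" "k \<in> V" "\<And>S. f (insert k S) = f S"
  shows "subset_mean V p (\<lambda>S. of_bool (k \<in> S) * f S) = p * subset_mean V p f"
  by (subst subset_mean_split[OF assms(1,2)])
     (simp add: assms(1,3) subset_mean_const)

lemma insert_invariant_remove:
  assumes "\<And>S. f (insert k S) = f S" shows "f (S - {k}) = f S"
  using assms[of "S - {k}"] assms[of S] by simp

lemma subset_mean_nonmember:
  assumes "finite V" "k \<in> V" "\<And>S. f (insert k S) = f S"
  shows "subset_mean V p (\<lambda>S. of_bool (k \<notin> S) * f S) = (1 - p) * subset_mean V p f"
  by (subst subset_mean_split[OF assms(1,2)])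
     (simp add: assms(1) insert_invariant_remove[of f, OF assms(3)] subset_mean_const)

text \<open>Raising the probability of the vertex \<open>k\<close> moves weight from \<open>f S\<close> to the larger value
  \<open>f (insert k S)\<close>; induction over \<open>V\<close> does this for one vertex after the other.\<close>

lemma subset_mean_mono_prob:
  assumes "finite V" "0 \<le> p" "p \<le> p'" "p' \<le> 1" "mono f"
  shows "subset_mean V p f \<le> subset_mean V p' f"
  using assms(1,5)
proof (induction V arbitrary: f rule: finite_induct)
  case empty
  show ?case by (simp add: subset_mean_def)
next
  case (insert k V)
  have mono1: "mono (\<lambda>S. f (insert k S))"
    using insert.prems by (auto simp: mono_def intro!: monoD[OF insert.prems])
  have "subset_mean V p' f \<le> subset_mean V p' (\<lambda>S. f (insert k S))"
    using assms by (intro subset_mean_mono monoD[OF insert.prems]) auto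
  then have "0 \<le> (p' - p) * (subset_mean V p' (\<lambda>S. f (insert k S)) - subset_mean V p' f)"
    using assms by simp
  moreover have "(1 - p) * subset_mean V p f \<le> (1 - p) * subset_mean V p' f"
    using assms insert by (intro mult_left_mono) auto
  moreover have "p * subset_mean V p (\<lambda>S. f (insert k S)) \<le> p * subset_mean V p' (\<lambda>S. f (insert k S))"
    using assms insert.IH[OF mono1] by (intro mult_left_mono) auto
  ultimately show ?case
    using insert.hyps by (simp add: subset_mean_insert algebra_simps)
qed

section \<open>Correlation of monotone functions\<close>

definition covar :: "'a set \<Rightarrow> real \<Rightarrow> ('a set \<Rightarrow> real) \<Rightarrow> ('a set \<Rightarrow> real) \<Rightarrow> real" where
  "covar V p f g =
     subset_mean V p (\<lambda>S. f S * g S) - subset_mean V p f * subset_mean V p g"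

text \<open>The law of total covariance with respect to the vertex \<open>k\<close>: the mean of the covariances of
  the two sections, plus the covariance of the two conditional means. Harris' inequality and the
  upper bound for covariances are both obtained by iterating this identity.\<close>

lemma covar_insert:
  assumes "finite V" "k \<notin> V"
  shows "covar (insert k V) p f g =
      (1 - p) * covar V p f g + p * covar V p (\<lambda>S. f (insert k S)) (\<lambda>S. g (insert k S))
    + p * (1 - p) * (subset_mean V p (\<lambda>S. f (insert k S) - f S)
                   * subset_mean V p (\<lambda>S. g (insert k S) - g S))"
  using assms by (simp add: covar_def subset_mean_insert subset_mean_diff algebra_simps)

lemma covar_complement:
  assumes "finite V"
  shows "covar V p (\<lambda>S. 1 - f S) (\<lambda>S. 1 - g S) = covar V p f g"
proof -
  have "(\<lambda>S. (1 - f S) * (1 - g S)) = (\<lambda>S. (1 - f S) - (g S - f S * g S))"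
    by (simp add: algebra_simps)
  then have "subset_mean V p (\<lambda>S. (1 - f S) * (1 - g S))
      = 1 - subset_mean V p f - (subset_mean V p g - subset_mean V p (\<lambda>S. f S * g S))"
    by (simp only: subset_mean_diff subset_mean_const[OF assms])
  then show ?thesis
    unfolding covar_def subset_mean_diff subset_mean_const[OF assms] by (simp add: algebra_simps)
qed

text \<open>The common direction of monotonicity may depend on the coordinate. This generality is needed
  for the functions in \<open>covar_matchings_below_le\<close>, which increase in one vertex and decrease in
  others.\<close>

definition comonotone :: "('a set \<Rightarrow> real) \<Rightarrow> ('a set \<Rightarrow> real) \<Rightarrow> bool" where
  "comonotone f g \<longleftrightarrow>
     (\<forall>k. (\<forall>S. f S \<le> f (insert k S) \<and> g S \<le> g (insert k S))
        \<or> (\<forall>S. f (insert k S) \<le> f S \<and> g (insert k S) \<le> g S))"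

lemma comonotone_section:
  assumes "comonotone f g"
  shows "comonotone (\<lambda>S. f (insert k S)) (\<lambda>S. g (insert k S))"
  unfolding comonotone_def
proof
  fix j
  show "(\<forall>S. f (insert k S) \<le> f (insert k (insert j S)) \<and> g (insert k S) \<le> g (insert k (insert j S)))
      \<or> (\<forall>S. f (insert k (insert j S)) \<le> f (insert k S) \<and> g (insert k (insert j S)) \<le> g (insert k S))"
    using assms[unfolded comonotone_def, rule_format, of j] by (metis insert_commute)
qed

lemma comonotone_mono: "mono f \<Longrightarrow> mono g \<Longrightarrow> comonotone f g"
  unfolding comonotone_def by (auto intro: monoD)

lemma comonotone_antimono: "antimono f \<Longrightarrow> antimono g \<Longrightarrow> comonotone f g"
  unfolding comonotone_def by (auto intro: antimonoD)

text \<open>Harris' inequality: in \<open>covar_insert\<close> the last product has two factors of the same sign.\<close>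

lemma covar_nonneg:
  assumes "finite V" "0 \<le> p" "p \<le> 1" "comonotone f g"
  shows "0 \<le> covar V p f g"
  using assms(1,4)
proof (induction V arbitrary: f g rule: finite_induct)
  case empty
  show ?case by (simp add: covar_def subset_mean_def)
next
  case (insert k V)
  let ?Df = "subset_mean V p (\<lambda>S. f (insert k S) - f S)"
  let ?Dg = "subset_mean V p (\<lambda>S. g (insert k S) - g S)"
  consider "\<forall>S. f S \<le> f (insert k S) \<and> g S \<le> g (insert k S)"
    | "\<forall>S. f (insert k S) \<le> f S \<and> g (insert k S) \<le> g S"
    using insert.prems unfolding comonotone_def by blast
  then have "0 \<le> ?Df * ?Dg"
  proof cases
    case 1
    have "subset_mean V p (\<lambda>_. 0) \<le> ?Df" "subset_mean V p (\<lambda>_. 0) \<le> ?Dg"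
      using 1 assms by (intro subset_mean_mono; simp)+
    then show ?thesis using insert by (simp add: subset_mean_const)
  next
    case 2
    have "?Df \<le> subset_mean V p (\<lambda>_. 0)" "?Dg \<le> subset_mean V p (\<lambda>_. 0)"
      using 2 assms by (intro subset_mean_mono; simp)+
    then show ?thesis using insert by (simp add: subset_mean_const mult_nonpos_nonpos)
  qed
  then show ?case
    using insert.hyps assms insert.IH[OF insert.prems]
      insert.IH[OF comonotone_section[OF insert.prems]]
    by (simp add: covar_insert)
qed

corollary subset_mean_mult_ge:
  assumes "finite V" "0 \<le> p" "p \<le> 1" "comonotone f g"
  shows "subset_mean V p f * subset_mean V p g \<le> subset_mean V p (\<lambda>S. f S * g S)"
  using covar_nonneg[OF assms] by (simp add: covar_def)

text \<open>Iterating \<open>covar_insert\<close> writes the covariance as a sum over the vertices \<open>k\<close>, in which each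
  summand is the mean of a product of two conditional means, namely of the drops of \<open>f\<close> and of \<open>g\<close> at
  \<open>k\<close> given the vertices exposed before. Replacing the drops by comonotone upper bounds \<open>P k\<close> and
  \<open>Q k\<close> allows Harris' inequality to merge the two conditional means into one joint mean.\<close>

lemma covar_le_sum_influences:
  assumes "finite V" "0 \<le> p" "p \<le> 1"
    and "\<And>k. k \<in> V \<Longrightarrow> comonotone (P k) (Q k)"
    and "\<And>k S. k \<in> V \<Longrightarrow> f (insert k S) \<le> f (S - {k}) \<and> f (S - {k}) - f (insert k S) \<le> P k S"
    and "\<And>k S. k \<in> V \<Longrightarrow> g (insert k S) \<le> g (S - {k}) \<and> g (S - {k}) - g (insert k S) \<le> Q k S"
  shows "covar V p f g \<le> p * (1 - p) * (\<Sum>k\<in>V. subset_mean V p (\<lambda>S. P k S * Q k S))"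
  using assms(1,4-)
proof (induction V arbitrary: f g P Q rule: finite_induct)
  case empty
  show ?case by (simp add: covar_def subset_mean_def)
next
  case (insert k V)
  let ?V = "insert k V"
  have fin: "finite ?V" using insert by simp
  let ?PQ = "\<lambda>j S. P j S * Q j S"
  have IH0: "covar V p f g \<le> p * (1 - p) * (\<Sum>j\<in>V. subset_mean V p (?PQ j))"
    by (intro insert.IH insert.prems) auto
  have IH1: "covar V p (\<lambda>S. f (insert k S)) (\<lambda>S. g (insert k S))
      \<le> p * (1 - p) * (\<Sum>j\<in>V. subset_mean V p (\<lambda>S. ?PQ j (insert k S)))"
  proof (rule insert.IH)
    fix j S assume j: "j \<in> V"
    then have eq: "insert k (S - {j}) = insert k S - {j}" "insert k (insert j S) = insert j (insert k S)"
      using insert.hyps by auto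
    show "f (insert k (insert j S)) \<le> f (insert k (S - {j})) \<and>
        f (insert k (S - {j})) - f (insert k (insert j S)) \<le> P j (insert k S)"
      unfolding eq using j insert.prems(2)[of j "insert k S"] by simp
    show "g (insert k (insert j S)) \<le> g (insert k (S - {j})) \<and>
        g (insert k (S - {j})) - g (insert k (insert j S)) \<le> Q j (insert k S)"
      unfolding eq using j insert.prems(3)[of j "insert k S"] by simp
  qed (rule comonotone_section[OF insert.prems(1)], simp)
  \<comment> \<open>The drop of a function at \<open>k\<close> does not depend on whether \<open>k\<close> is chosen, so its mean over
     subsets of \<open>V\<close> is a mean over subsets of \<open>insert k V\<close>.\<close>
  have drop: "subset_mean V p (\<lambda>S. h (insert k S) - h S)
      = - subset_mean ?V p (\<lambda>S. h (S - {k}) - h (insert k S))" for h :: "'a set \<Rightarrow> real"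
  proof -
    have "subset_mean V p (\<lambda>S. h (S - {k})) = subset_mean V p h"
      "subset_mean V p (\<lambda>S. h (insert k S - {k})) = subset_mean V p h"
      using insert.hyps by (intro subset_mean_cong arg_cong[of _ _ h]; auto)+
    then show ?thesis
      using insert.hyps by (simp add: subset_mean_insert subset_mean_diff algebra_simps)
  qed
  let ?Df = "subset_mean ?V p (\<lambda>S. f (S - {k}) - f (insert k S))"
  let ?Dg = "subset_mean ?V p (\<lambda>S. g (S - {k}) - g (insert k S))"
  have f: "?Df \<le> subset_mean ?V p (P k)" "?Dg \<le> subset_mean ?V p (Q k)"
    using insert.prems assms(2,3) by (intro subset_mean_mono; simp)+
  have "subset_mean ?V p (\<lambda>_. 0) \<le> ?Df" "subset_mean ?V p (\<lambda>_. 0) \<le> ?Dg"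
    using insert.prems assms(2,3) by (intro subset_mean_mono; simp)+
  then have "?Df * ?Dg \<le> subset_mean ?V p (P k) * subset_mean ?V p (Q k)"
    using f fin by (intro mult_mono) (simp_all add: subset_mean_const)
  also have "\<dots> \<le> subset_mean ?V p (?PQ k)"
    using insert.prems fin assms(2,3) by (intro subset_mean_mult_ge) auto
  finally have D: "p * (1 - p) * (?Df * ?Dg) \<le> p * (1 - p) * subset_mean ?V p (?PQ k)"
    using assms by (intro mult_left_mono) auto
  have "covar ?V p f g \<le> (1 - p) * (p * (1 - p) * (\<Sum>j\<in>V. subset_mean V p (?PQ j)))
     + p * (p * (1 - p) * (\<Sum>j\<in>V. subset_mean V p (\<lambda>S. ?PQ j (insert k S))))
     + p * (1 - p) * subset_mean ?V p (?PQ k)"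
    unfolding covar_insert[OF insert.hyps] drop minus_mult_minus
    using assms(2,3) by (intro add_mono mult_left_mono IH0 IH1 D) auto
  also have "(1 - p) * (p * (1 - p) * (\<Sum>j\<in>V. subset_mean V p (?PQ j)))
     + p * (p * (1 - p) * (\<Sum>j\<in>V. subset_mean V p (\<lambda>S. ?PQ j (insert k S))))
     = p * (1 - p) * (\<Sum>j\<in>V. subset_mean ?V p (?PQ j))"
  proof -
    have "(\<Sum>j\<in>V. subset_mean ?V p (?PQ j)) = (1 - p) * (\<Sum>j\<in>V. subset_mean V p (?PQ j))
        + p * (\<Sum>j\<in>V. subset_mean V p (\<lambda>S. ?PQ j (insert k S)))"
      using insert.hyps by (simp add: subset_mean_insert sum.distrib sum_distrib_left)
    then show ?thesis by (simp only:) (simp add: algebra_simps)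
  qed
  finally show ?case
    using insert.hyps by (simp add: algebra_simps)
qed

text \<open>For increasing events the lower bound is Harris' inequality. The upper bound is an inequality of
  Newman: when an event is added, its covariance with the conjunction of the previous ones is at most
  the sum of its covariances with the individual events, because the number of previous events that
  occur minus the indicator of their conjunction is still increasing.\<close>

lemma mean_all_near_prod:
  fixes G :: "'b \<Rightarrow> 'a set \<Rightarrow> bool"
  assumes V: "finite V" "0 \<le> p" "p \<le> 1" and J: "finite J"
    and up: "\<And>j. j \<in> J \<Longrightarrow> mono (G j)"
    and cov: "\<And>i j. i \<in> J \<Longrightarrow> j \<in> J \<Longrightarrow> i \<noteq> j \<Longrightarrow>
        covar V p (\<lambda>S. of_bool (G i S)) (\<lambda>S. of_bool (G j S)) \<le> c"
    and c: "0 \<le> c"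
  shows "(\<Prod>j\<in>J. subset_mean V p (\<lambda>S. of_bool (G j S)))
           \<le> subset_mean V p (\<lambda>S. of_bool (\<forall>j\<in>J. G j S))"
    and "subset_mean V p (\<lambda>S. of_bool (\<forall>j\<in>J. G j S))
           \<le> (\<Prod>j\<in>J. subset_mean V p (\<lambda>S. of_bool (G j S))) + real (card J) ^ 2 * c"
proof -
  let ?m = "subset_mean V p"
  let ?G = "\<lambda>j S. of_bool (G j S) :: real"
  have up': "mono (?G j)" if "j \<in> J" for j
    using up[OF that] by (auto simp: mono_def le_bool_def of_bool_def)
  have m01: "0 \<le> ?m (\<lambda>S. of_bool (Q S))" "?m (\<lambda>S. of_bool (Q S)) \<le> 1" for Q :: "'a set \<Rightarrow> bool"
    using subset_mean_mono[OF V(2,3), where V = V and f = "\<lambda>_. 0" and g = "\<lambda>S. of_bool (Q S)"]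
      subset_mean_mono[OF V(2,3), where V = V and g = "\<lambda>_. 1" and f = "\<lambda>S. of_bool (Q S)"]
    by (auto simp: V subset_mean_const)
  have "(\<Prod>j\<in>K. ?m (?G j)) \<le> ?m (\<lambda>S. of_bool (\<forall>j\<in>K. G j S)) \<and>
    ?m (\<lambda>S. of_bool (\<forall>j\<in>K. G j S)) \<le> (\<Prod>j\<in>K. ?m (?G j)) + real (card K) ^ 2 * c"
    if "K \<subseteq> J" for K
    using finite_subset[OF that J] that
  proof (induction K rule: finite_induct)
    case empty
    show ?case using V by (simp add: subset_mean_const)
  next
    case (insert x K)
    let ?A = "\<lambda>S. of_bool (\<forall>j\<in>K. G j S) :: real"
    have x: "x \<in> J" and K: "K \<subseteq> J" using insert.prems by auto
    have IH: "(\<Prod>j\<in>K. ?m (?G j)) \<le> ?m ?A"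
      "?m ?A \<le> (\<Prod>j\<in>K. ?m (?G j)) + real (card K) ^ 2 * c"
      using insert.IH K by auto
    have upA: "mono ?A"
      using up K by (auto simp: mono_def le_bool_def of_bool_def)
    have eq: "?m (\<lambda>S. of_bool (\<forall>j\<in>insert x K. G j S)) = ?m (\<lambda>S. ?A S * ?G x S)"
      by (intro subset_mean_cong) auto
    have lower: "?m ?A * ?m (?G x) \<le> ?m (\<lambda>S. ?A S * ?G x S)"
      by (intro subset_mean_mult_ge V comonotone_mono upA up' x)
    \<comment> \<open>The number of good indices exceeds the indicator that all are good by an
       increasing function, because the last good index adds one to both.\<close>
    let ?f = "\<lambda>S. (\<Sum>j\<in>K. ?G j S) - ?A S"
    have upf: "mono ?f"
    proof (rule monoI)
      fix S T :: "'a set" assume ST: "S \<subseteq> T"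
      have le: "?G j S \<le> ?G j T" if "j \<in> K" for j
        using monoD[OF up'[OF subsetD[OF K that]] ST] .
      show "?f S \<le> ?f T"
      proof (cases "(\<forall>j\<in>K. G j T) \<and> \<not> (\<forall>j\<in>K. G j S)")
        case True
        then obtain y where y: "y \<in> K" "\<not> G y S" "G y T" by auto
        have "(\<Sum>j\<in>K. ?G j S) = (\<Sum>j\<in>K - {y}. ?G j S)"
          using y insert.hyps by (simp add: sum.remove[of K y] del: sum_of_bool_eq)
        also have "\<dots> \<le> (\<Sum>j\<in>K - {y}. ?G j T)" using le by (intro sum_mono) auto
        also have "\<dots> = (\<Sum>j\<in>K. ?G j T) - 1"
          using y insert.hyps by (simp add: sum.remove[of K y] del: sum_of_bool_eq)
        finally have "(\<Sum>j\<in>K. ?G j S) \<le> (\<Sum>j\<in>K. ?G j T) - 1" .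
        moreover have "?A S = 0" "?A T = 1" using True by auto
        ultimately show ?thesis by linarith
      next
        case False
        have "?A T \<le> ?A S" using False by auto
        moreover have "(\<Sum>j\<in>K. ?G j S) \<le> (\<Sum>j\<in>K. ?G j T)" using le by (intro sum_mono) auto
        ultimately show ?thesis by linarith
      qed
    qed
    have "0 \<le> covar V p ?f (?G x)"
      by (intro covar_nonneg V comonotone_mono upf up' x)
    also have "covar V p ?f (?G x)
        = (\<Sum>j\<in>K. covar V p (?G j) (?G x)) - (?m (\<lambda>S. ?A S * ?G x S) - ?m ?A * ?m (?G x))"
      by (simp add: covar_def left_diff_distrib sum_distrib_right subset_mean_diff subset_mean_sum
          sum_subtractf del: of_bool_conj)
    also have "(\<Sum>j\<in>K. covar V p (?G j) (?G x)) \<le> real (card K) * c"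
      using K x insert.hyps by (intro sum_bounded_above cov) auto
    finally have upper: "?m (\<lambda>S. ?A S * ?G x S) \<le> ?m ?A * ?m (?G x) + real (card K) * c"
      by linarith
    have "(\<Prod>j\<in>insert x K. ?m (?G j)) = ?m (?G x) * (\<Prod>j\<in>K. ?m (?G j))"
      using insert.hyps by simp
    also have "\<dots> \<le> ?m (?G x) * ?m ?A" using IH m01 by (intro mult_left_mono) auto
    finally have 1: "(\<Prod>j\<in>insert x K. ?m (?G j)) \<le> ?m (\<lambda>S. of_bool (\<forall>j\<in>insert x K. G j S))"
      unfolding eq using lower by (simp add: mult.commute)
    have "?m ?A * ?m (?G x) \<le> ((\<Prod>j\<in>K. ?m (?G j)) + real (card K) ^ 2 * c) * ?m (?G x)"
      using IH m01 by (intro mult_right_mono) auto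
    also have "\<dots> \<le> (\<Prod>j\<in>K. ?m (?G j)) * ?m (?G x) + real (card K) ^ 2 * c"
      using m01(2)[of "G x"] c by (simp add: distrib_right mult_left_le)
    finally have "?m (\<lambda>S. of_bool (\<forall>j\<in>insert x K. G j S))
        \<le> (\<Prod>j\<in>K. ?m (?G j)) * ?m (?G x) + real (card K) ^ 2 * c + real (card K) * c"
      unfolding eq using upper by linarith
    also have "\<dots> \<le> (\<Prod>j\<in>insert x K. ?m (?G j)) + real (card (insert x K)) ^ 2 * c"
      using insert.hyps c by (simp add: power2_eq_square algebra_simps)
    finally show ?case using 1 by blast
  qed
  from this[OF order_refl]
  show "(\<Prod>j\<in>J. ?m (?G j)) \<le> ?m (\<lambda>S. of_bool (\<forall>j\<in>J. G j S))"
    and "?m (\<lambda>S. of_bool (\<forall>j\<in>J. G j S)) \<le> (\<Prod>j\<in>J. ?m (?G j)) + real (card J) ^ 2 * c"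
    by auto
qed

section \<open>Edges of a graph inside a random set of vertices\<close>

definition edges_inside :: "'a set set \<Rightarrow> 'a set \<Rightarrow> nat" where
  "edges_inside G S = card {e \<in> G. e \<subseteq> S}"

lemma edges_inside_mono: "finite G \<Longrightarrow> S \<subseteq> T \<Longrightarrow> edges_inside G S \<le> edges_inside G T"
  unfolding edges_inside_def by (intro card_mono) auto

lemma edges_inside_mono_graph: "finite G \<Longrightarrow> H \<subseteq> G \<Longrightarrow> edges_inside H S \<le> edges_inside G S"
  unfolding edges_inside_def by (intro card_mono) auto

lemma edges_inside_insert:
  assumes "finite G" "e \<notin> G"
  shows "edges_inside (insert e G) S = edges_inside G S + of_bool (e \<subseteq> S)"
proof -
  have "{e' \<in> insert e G. e' \<subseteq> S} = (if e \<subseteq> S then insert e {e' \<in> G. e' \<subseteq> S} else {e' \<in> G. e' \<subseteq> S})"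
    by auto
  then show ?thesis using assms by (simp add: edges_inside_def)
qed

lemma edges_inside_union:
  assumes "finite G" "finite H" "G \<inter> H = {}"
  shows "edges_inside (G \<union> H) S = edges_inside G S + edges_inside H S"
proof -
  have "{e \<in> G \<union> H. e \<subseteq> S} = {e \<in> G. e \<subseteq> S} \<union> {e \<in> H. e \<subseteq> S}" by auto
  then show ?thesis
    unfolding edges_inside_def using assms by (simp only:) (intro card_Un_disjoint; auto)
qed

lemma edges_inside_ignores:
  assumes "\<And>e. e \<in> G \<Longrightarrow> k \<notin> e"
  shows "edges_inside G (insert k S) = edges_inside G S"
  unfolding edges_inside_def using assms by (intro arg_cong[of _ _ card]) auto

lemma antimono_power_edges_inside:
  assumes "finite G" "0 \<le> s" "s \<le> (1::real)"
  shows "antimono (\<lambda>S. s ^ edges_inside G S)"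
  using assms by (intro antimonoI power_decreasing edges_inside_mono) auto

lemma subset_mean_contains:
  assumes "finite V" "finite U" "U \<subseteq> V" "\<And>k S. k \<in> U \<Longrightarrow> f (insert k S) = f S"
  shows "subset_mean V p (\<lambda>S. of_bool (U \<subseteq> S) * f S) = p ^ card U * subset_mean V p f"
  using assms(2,3,4)
proof (induction U rule: finite_induct)
  case (insert u U)
  have "subset_mean V p (\<lambda>S. of_bool (insert u U \<subseteq> S) * f S)
      = subset_mean V p (\<lambda>S. of_bool (u \<in> S) * (of_bool (U \<subseteq> S) * f S))"
    by (intro subset_mean_cong) auto
  also have "\<dots> = p * subset_mean V p (\<lambda>S. of_bool (U \<subseteq> S) * f S)"
    using insert by (intro subset_mean_member assms) (auto simp: subset_insert)
  also have "\<dots> = p * (p ^ card U * subset_mean V p f)"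
    using insert by simp
  finally show ?case using insert by simp
qed simp

lemma subset_mean_avoid:
  assumes "finite V" "finite U" "U \<subseteq> V"
  shows "subset_mean V p (\<lambda>S. of_bool (U \<inter> S = {})) = (1 - p) ^ card U"
  using assms(2,3)
proof (induction U rule: finite_induct)
  case empty
  then show ?case using assms by (simp add: subset_mean_const)
next
  case (insert u U)
  have "subset_mean V p (\<lambda>S. of_bool (insert u U \<inter> S = {}))
      = subset_mean V p (\<lambda>S. of_bool (u \<notin> S) * of_bool (U \<inter> S = {}))"
    by (intro subset_mean_cong) auto
  also have "\<dots> = (1 - p) * subset_mean V p (\<lambda>S. of_bool (U \<inter> S = {}))"
    using insert by (intro subset_mean_nonmember assms) auto
  finally show ?case using insert by simp
qed

text \<open>The factor gained per edge in the next lemma.\<close>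

lemma edge_factor_range:
  fixes p s :: real
  assumes "0 \<le> p" "p \<le> 1" "0 \<le> s" "s \<le> 1"
  shows "0 \<le> 1 - (1 - s) * (p * (1 - p))\<^sup>2" "1 - (1 - s) * (p * (1 - p))\<^sup>2 \<le> 1"
proof -
  have "0 \<le> p * (1 - p)" "p * (1 - p) \<le> 1" using assms by (auto intro: mult_le_one)
  then have "(p * (1 - p))\<^sup>2 \<le> 1" by (rule power_le_one)
  then have "(1 - s) * (p * (1 - p))\<^sup>2 \<le> 1" using assms by (intro mult_le_one) auto
  then show "0 \<le> 1 - (1 - s) * (p * (1 - p))\<^sup>2" "1 - (1 - s) * (p * (1 - p))\<^sup>2 \<le> 1"
    using assms by auto
qed

text \<open>An estimate of Janson type for \<open>s ^ X\<close>, where \<open>X\<close> is the number of edges inside the random set.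
  Adding an edge \<open>e\<close> lowers the mean of \<open>s ^ X\<close> by \<open>1 - s\<close> times its part on the event
  \<open>e \<subseteq> S\<close>. That part is bounded below by requiring that the at most two neighbours of \<open>e\<close>
  are absent. Then the edges meeting \<open>e\<close> are not inside the set, the remaining ones do not depend on \<open>e\<close>,
  and Harris' inequality decouples them from the absence of the neighbours. The factor
  \<open>(p * (1 - p))\<^sup>2\<close> is the probability that \<open>e\<close> is inside while two neighbours are absent.\<close>

lemma mean_power_edges_inside_le:
  fixes G :: "'a set set"
  assumes V: "finite V" "0 \<le> p" "p \<le> 1" and s: "0 \<le> s" "s \<le> 1" and G: "finite G"
    and edge: "\<And>e. e \<in> G \<Longrightarrow> e \<subseteq> V \<and> card e = 2"
    and deg: "\<And>v. card {e \<in> G. v \<in> e} \<le> 2"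
  shows "subset_mean V p (\<lambda>S. s ^ edges_inside G S) \<le> (1 - (1 - s) * (p * (1 - p))\<^sup>2) ^ card G"
  using G edge deg
proof (induction G rule: finite_induct)
  case empty
  then show ?case using V by (simp add: edges_inside_def subset_mean_const)
next
  case (insert e G)
  let ?m = "subset_mean V p" and ?q = "(p * (1 - p))\<^sup>2"
  have fe: "finite e" using insert.prems(1)[of e] V finite_subset by blast
  have fe': "finite e'" if "e' \<in> G" for e'
    using insert.prems(1)[of e'] V finite_subset that by blast
  \<comment> \<open>\<open>H\<close> consists of the edges that avoid \<open>e\<close>, and \<open>U\<close> of the neighbours of \<open>e\<close>.\<close>
  define H where "H = {e' \<in> G. e' \<inter> e = {}}"
  define U where "U = (\<Union>v\<in>e. \<Union>e'\<in>{e'\<in>G. v \<in> e'}. e' - {v}) - e"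
  have deg1: "card {e' \<in> G. v \<in> e'} \<le> 1" if "v \<in> e" for v
  proof -
    have "card (insert e {e' \<in> G. v \<in> e'}) \<le> card {e' \<in> insert e G. v \<in> e'}"
      using insert.hyps that by (intro card_mono) auto
    also have "\<dots> \<le> 2" by (rule insert.prems)
    finally show ?thesis using insert.hyps by simp
  qed
  have "card (\<Union>v\<in>e. \<Union>e'\<in>{e'\<in>G. v \<in> e'}. e' - {v}) \<le> (\<Sum>v\<in>e. card (\<Union>e'\<in>{e'\<in>G. v \<in> e'}. e' - {v}))"
    by (rule card_UN_le[OF fe])
  also have "\<dots> \<le> (\<Sum>v\<in>e. 1)"
  proof (rule sum_mono)
    fix v assume v: "v \<in> e"
    have "card (\<Union>e'\<in>{e'\<in>G. v \<in> e'}. e' - {v}) \<le> (\<Sum>e'\<in>{e'\<in>G. v \<in> e'}. card (e' - {v}))"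
      using insert.hyps by (intro card_UN_le) auto
    also have "\<dots> = (\<Sum>e'\<in>{e'\<in>G. v \<in> e'}. 1)"
      using insert.prems(1) fe' by (intro sum.cong refl) (simp add: card_Diff_singleton)
    also have "\<dots> \<le> 1" using deg1[OF v] by simp
    finally show "card (\<Union>e'\<in>{e'\<in>G. v \<in> e'}. e' - {v}) \<le> 1" .
  qed
  also have "\<dots> = 2" using insert.prems(1) by simp
  finally have "card (\<Union>v\<in>e. \<Union>e'\<in>{e'\<in>G. v \<in> e'}. e' - {v}) \<le> 2" .
  moreover have UV: "U \<subseteq> V" using insert.prems(1) by (auto simp: U_def)
  have finU: "finite U" using UV V finite_subset by blast
  have "finite (\<Union>v\<in>e. \<Union>e'\<in>{e'\<in>G. v \<in> e'}. e' - {v})"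
    using fe fe' insert.hyps by auto
  then have "card U \<le> card (\<Union>v\<in>e. \<Union>e'\<in>{e'\<in>G. v \<in> e'}. e' - {v})"
    unfolding U_def by (intro card_mono) auto
  ultimately have cardU: "card U \<le> 2" by linarith
  have eqH: "edges_inside G S = edges_inside H S" if "e \<subseteq> S" "U \<inter> S = {}" for S
  proof -
    have "e' \<inter> e = {}" if e': "e' \<in> G" "e' \<subseteq> S" for e'
    proof (rule ccontr)
      assume "e' \<inter> e \<noteq> {}"
      then obtain v where v: "v \<in> e" "v \<in> e'" by blast
      have "\<not> e' \<subseteq> e"
        using card_subset_eq[OF fe, of e'] insert.prems(1)[of e] insert.prems(1)[of e'] e' insert.hyps
        by auto
      then obtain u where u: "u \<in> e'" "u \<notin> e" by blast
      then have "u \<in> U" using v e' by (auto simp: U_def)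
      then show False using \<open>U \<inter> S = {}\<close> u e' by blast
    qed
    then show ?thesis unfolding edges_inside_def H_def by (intro arg_cong[of _ _ card]) auto
  qed
  have H: "finite H" "H \<subseteq> G" using insert.hyps by (auto simp: H_def)
  have "?q * ?m (\<lambda>S. s ^ edges_inside G S) \<le> ?q * ?m (\<lambda>S. s ^ edges_inside H S)"
    using V s H insert.hyps by (intro mult_left_mono subset_mean_mono power_decreasing edges_inside_mono_graph) auto
  also have "\<dots> = p ^ 2 * ((1 - p) ^ 2 * ?m (\<lambda>S. s ^ edges_inside H S))"
    by (simp add: power_mult_distrib)
  also have "\<dots> \<le> p ^ 2 * ((1 - p) ^ card U * ?m (\<lambda>S. s ^ edges_inside H S))"
  proof (intro mult_left_mono mult_right_mono power_decreasing)
    have "?m (\<lambda>_. 0) \<le> ?m (\<lambda>S. s ^ edges_inside H S)"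
      using V s by (intro subset_mean_mono) auto
    then show "0 \<le> ?m (\<lambda>S. s ^ edges_inside H S)" using V by (simp add: subset_mean_const)
  qed (use V cardU in auto)
  also have "\<dots> = p ^ 2 * (?m (\<lambda>S. of_bool (U \<inter> S = {})) * ?m (\<lambda>S. s ^ edges_inside H S))"
    using V UV finU by (simp add: subset_mean_avoid)
  also have "\<dots> \<le> p ^ 2 * ?m (\<lambda>S. of_bool (U \<inter> S = {}) * s ^ edges_inside H S)"
    using V s H
    by (intro mult_left_mono subset_mean_mult_ge comonotone_antimono antimono_power_edges_inside)
       (auto simp: monotone_def)
  also have "\<dots> = ?m (\<lambda>S. of_bool (e \<subseteq> S) * (of_bool (U \<inter> S = {}) * s ^ edges_inside H S))"
  proof -
    have "edges_inside H (insert k S) = edges_inside H S" "U \<inter> insert k S = U \<inter> S" if "k \<in> e" for k S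
      using that by (auto intro!: edges_inside_ignores simp: H_def U_def)
    then show ?thesis
      using insert.prems(1)[of e] fe by (subst subset_mean_contains[OF V(1) fe]) auto
  qed
  also have "\<dots> \<le> ?m (\<lambda>S. of_bool (e \<subseteq> S) * s ^ edges_inside G S)"
    using V s eqH by (intro subset_mean_mono) (auto simp: of_bool_def)
  finally have key: "?q * ?m (\<lambda>S. s ^ edges_inside G S) \<le> ?m (\<lambda>S. of_bool (e \<subseteq> S) * s ^ edges_inside G S)" .
  have "?m (\<lambda>S. s ^ edges_inside (insert e G) S)
      = ?m (\<lambda>S. s ^ edges_inside G S - (1 - s) * (of_bool (e \<subseteq> S) * s ^ edges_inside G S))"
    using insert.hyps by (intro subset_mean_cong) (auto simp: edges_inside_insert algebra_simps)
  also have "\<dots> = ?m (\<lambda>S. s ^ edges_inside G S) - (1 - s) * ?m (\<lambda>S. of_bool (e \<subseteq> S) * s ^ edges_inside G S)"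
    by (simp add: subset_mean_diff subset_mean_cmult)
  also have "\<dots> \<le> ?m (\<lambda>S. s ^ edges_inside G S) - (1 - s) * (?q * ?m (\<lambda>S. s ^ edges_inside G S))"
    using key s by (intro diff_left_mono mult_left_mono) auto
  also have "\<dots> = (1 - (1 - s) * ?q) * ?m (\<lambda>S. s ^ edges_inside G S)"
    by (simp add: algebra_simps)
  also have "\<dots> \<le> (1 - (1 - s) * ?q) * (1 - (1 - s) * ?q) ^ card G"
  proof (intro mult_left_mono insert.IH)
    show "card {e \<in> G. v \<in> e} \<le> 2" for v
    proof -
      have "card {e \<in> G. v \<in> e} \<le> card {e' \<in> insert e G. v \<in> e'}"
        using insert.hyps by (intro card_mono) auto
      also have "\<dots> \<le> 2" by (rule insert.prems)
      finally show ?thesis .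
    qed
    show "0 \<le> 1 - (1 - s) * ?q" using V s by (intro edge_factor_range)
  qed (use insert.prems(1) in auto)
  finally show ?case using insert.hyps by simp
qed

section \<open>Covariances for two disjoint matchings\<close>

definition matching :: "'a set \<Rightarrow> 'a set set \<Rightarrow> bool" where
  "matching V M \<longleftrightarrow> finite M \<and> (\<forall>e\<in>M. e \<subseteq> V \<and> card e = 2) \<and> (\<forall>e\<in>M. \<forall>e'\<in>M. e \<noteq> e' \<longrightarrow> e \<inter> e' = {})"

lemma matching_subset: "matching V M \<Longrightarrow> N \<subseteq> M \<Longrightarrow> matching V N"
  unfolding matching_def by (metis (no_types, lifting) finite_subset subsetD)

lemma matching_card_at:
  assumes "matching V M"
  shows "card {e \<in> M. v \<in> e} \<le> 1"
proof -
  have "\<forall>e\<in>{e \<in> M. v \<in> e}. \<forall>e'\<in>{e \<in> M. v \<in> e}. e = e'"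
    using assms unfolding matching_def by blast
  moreover have "finite {e \<in> M. v \<in> e}" using assms by (simp add: matching_def)
  ultimately show ?thesis by (simp add: card_le_Suc0_iff_eq)
qed

lemma matching_card_away:
  assumes "matching V M" "finite T"
  shows "card M \<le> card {e \<in> M. e \<inter> T = {}} + card T"
proof -
  have fin: "finite M" using assms by (simp add: matching_def)
  have "M \<subseteq> {e \<in> M. e \<inter> T = {}} \<union> (\<Union>v\<in>T. {e \<in> M. v \<in> e})" by blast
  then have "card M \<le> card ({e \<in> M. e \<inter> T = {}} \<union> (\<Union>v\<in>T. {e \<in> M. v \<in> e}))"
    using fin assms by (intro card_mono) auto
  also have "\<dots> \<le> card {e \<in> M. e \<inter> T = {}} + card (\<Union>v\<in>T. {e \<in> M. v \<in> e})"
    by (rule card_Un_le)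
  also have "card (\<Union>v\<in>T. {e \<in> M. v \<in> e}) \<le> (\<Sum>v\<in>T. card {e \<in> M. v \<in> e})"
    by (rule card_UN_le[OF assms(2)])
  also have "\<dots> \<le> (\<Sum>v\<in>T. 1)" by (intro sum_mono matching_card_at[OF assms(1)])
  finally show ?thesis by simp
qed

lemma matching_obtain_partner:
  assumes "matching V M" "k \<in> \<Union>M"
  obtains u where "{k, u} \<in> M" "u \<noteq> k" "u \<in> V"
proof -
  obtain e where e: "e \<in> M" "k \<in> e" using assms by blast
  then have "card e = 2" using assms by (auto simp: matching_def)
  then obtain x y where xy: "e = {x, y}" "x \<noteq> y" by (auto simp: card_2_iff)
  define u where "u = (if k = x then y else x)"
  have u: "e = {k, u}" "u \<noteq> k" using xy e by (auto simp: u_def)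
  show ?thesis
  proof (rule that)
    show "{k, u} \<in> M" "u \<noteq> k" using u e by auto
    show "u \<in> V" using u e assms unfolding matching_def by blast
  qed
qed

text \<open>Choosing \<open>k\<close> can lift the number of inner edges to \<open>g\<close> only if the partner \<open>u\<close> of \<open>k\<close> is
  chosen and fewer than \<open>g\<close> other edges are inside. The latter indicator is at most \<open>s ^ X / s ^ g\<close>
  for the number \<open>X\<close> of inner edges avoiding any set \<open>T\<close> that contains \<open>k\<close>.\<close>

lemma matching_drop_le:
  assumes M: "matching V M" and k: "{k, u} \<in> M" "u \<noteq> k" and T: "k \<in> T" and s: "0 < s" "s \<le> (1::real)"
  shows "of_bool (edges_inside M (S - {k}) < g) - of_bool (edges_inside M (insert k S) < g)
      \<le> of_bool (u \<in> S) * (s ^ edges_inside {e \<in> M. e \<inter> T = {}} S / s ^ g)"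
proof -
  let ?N = "M - {{k, u}}" and ?L = "{e \<in> M. e \<inter> T = {}}"
  have fin: "finite M" using M by (simp add: matching_def)
  have N: "k \<notin> e" if "e \<in> ?N" for e
  proof -
    have "e \<inter> {k, u} = {}"
      using M k(1) that by (simp add: matching_def)
    then show ?thesis by auto
  qed
  have split: "edges_inside M R = edges_inside ?N R + of_bool ({k, u} \<subseteq> R)" for R
    using edges_inside_insert[of ?N "{k, u}" R] fin k by (simp add: insert_absorb)
  have ign: "edges_inside ?N (insert k R) = edges_inside ?N R" for R
    using N by (intro edges_inside_ignores) blast
  have ins: "edges_inside M (insert k S) = edges_inside ?N S + of_bool (u \<in> S)"
    using split[of "insert k S"] ign[of S] k by simp
  have rem: "edges_inside M (S - {k}) = edges_inside ?N S"
    using split[of "S - {k}"] ign[of "S - {k}"] ign[of S] by simp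
  have "edges_inside ?L S \<le> edges_inside ?N S"
    using fin T by (intro edges_inside_mono_graph) auto
  then have "1 \<le> s ^ edges_inside ?L S / s ^ g" if "edges_inside ?N S < g"
    using s that power_decreasing[of "edges_inside ?L S" g s] by (simp add: field_simps)
  moreover have "0 \<le> s ^ edges_inside ?L S / s ^ g" using s by simp
  ultimately show ?thesis unfolding ins rem by (auto simp: of_bool_def)
qed

text \<open>A vertex \<open>k\<close> influences both events only through its partners \<open>u\<close> and \<open>v\<close> in the two matchings,
  which differ because the matchings have no common edge. Deleting the edges that
  meet \<open>{k, u, v}\<close>, at most three in each matching, makes the remaining count independent of \<open>u\<close> and
  \<open>v\<close>, so the two partners contribute \<open>p\<^sup>2\<close>. The remaining edges of the two matchings form a
  graph of maximum degree two, to which \<open>mean_power_edges_inside_le\<close> applies.\<close>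

lemma covar_matchings_below_le:
  assumes V: "finite V" "0 \<le> p" "p \<le> 1" and s: "0 < s" "s \<le> 1"
    and M: "matching V M" "matching V M'" "M \<inter> M' = {}"
  shows "covar V p (\<lambda>S. of_bool (edges_inside M S < g)) (\<lambda>S. of_bool (edges_inside M' S < g))
    \<le> p * (1 - p) * (real (card V) *
        (p\<^sup>2 * (1 - (1 - s) * (p * (1 - p))\<^sup>2) ^ (card M + card M' - 6) / s ^ (2 * g)))"
proof -
  let ?f = "\<lambda>M S. of_bool (edges_inside M S < g) :: real"
  let ?b = "1 - (1 - s) * (p * (1 - p))\<^sup>2"
  let ?c = "p\<^sup>2 * ?b ^ (card M + card M' - 6) / s ^ (2 * g)"
  let ?drop = "\<lambda>M k S. ?f M (S - {k}) - ?f M (insert k S)"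
  have fin: "finite M" "finite M'" using M by (auto simp: matching_def)
  have b: "0 \<le> ?b" "?b \<le> 1" using V s by (intro edge_factor_range; simp)+
  have c: "0 \<le> ?c" using b s by simp
  have drop0: "?drop N k S = 0" if "k \<notin> \<Union>N" for N k S
    using that edges_inside_ignores[of N k "S - {k}"] by (auto simp: Union_eq)
  have drop1: "?drop N k S \<le> 1" for N k S by auto
  have anti: "?f N (insert k S) \<le> ?f N (S - {k})" if "finite N" for N k S
  proof -
    have "S - {k} \<subseteq> insert k S" by blast
    from edges_inside_mono[OF that this] show ?thesis by (auto simp: of_bool_def)
  qed
  \<comment> \<open>The requirements of \<open>covar_le_sum_influences\<close> on the upper bounds for the drops at \<open>k\<close>.\<close>
  define dominated where "dominated k P Q \<longleftrightarrow>
    comonotone P Q \<and> (\<forall>S. ?drop M k S \<le> P S \<and> ?drop M' k S \<le> Q S)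
      \<and> subset_mean V p (\<lambda>S. P S * Q S) \<le> ?c" for k P Q
  have "\<exists>P Q. dominated k P Q" if k: "k \<in> V" for k
  proof (cases "k \<in> \<Union>M \<and> k \<in> \<Union>M'")
    case False
    have zero: "subset_mean V p (\<lambda>S. 0) \<le> ?c" using V c by (simp add: subset_mean_const)
    have const: "comonotone (\<lambda>_. c) (\<lambda>_. d)" for c d by (simp add: comonotone_def)
    show ?thesis
    proof (cases "k \<in> \<Union>M")
      case True
      then have "?drop M' k S = 0" for S using False drop0[of k M'] by blast
      then have "\<forall>S. ?drop M k S \<le> 1 \<and> ?drop M' k S \<le> 0" by (metis drop1 order_refl)
      then show ?thesis
        using const[of 1 0] zero
        by (intro exI[of _ "\<lambda>_. 1"] exI[of _ "\<lambda>_. 0"]) (simp add: dominated_def)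
    next
      case False
      then have "?drop M k S = 0" for S using drop0[of k M] by blast
      then have "\<forall>S. ?drop M k S \<le> 0 \<and> ?drop M' k S \<le> 1" by (metis drop1 order_refl)
      then show ?thesis
        using const[of 0 1] zero
        by (intro exI[of _ "\<lambda>_. 0"] exI[of _ "\<lambda>_. 1"]) (simp add: dominated_def)
    qed
  next
    case True
    obtain u where u: "{k, u} \<in> M" "u \<noteq> k" "u \<in> V"
      using True matching_obtain_partner[OF M(1)] by metis
    obtain v where v: "{k, v} \<in> M'" "v \<noteq> k" "v \<in> V"
      using True matching_obtain_partner[OF M(2)] by metis
    have uv: "u \<noteq> v" using u v M(3) by auto
    let ?T = "{k, u, v}"
    define L where "L = {e \<in> M. e \<inter> ?T = {}}"
    define L' where "L' = {e \<in> M'. e \<inter> ?T = {}}"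
    have L: "finite L" "finite L'" "L \<inter> L' = {}" "L \<subseteq> M" "L' \<subseteq> M'"
      using fin M(3) by (auto simp: L_def L'_def)
    have ign: "edges_inside L (insert x S) = edges_inside L S" "edges_inside L' (insert x S) = edges_inside L' S"
      if "x \<in> ?T" for x S
      using that by (auto intro!: edges_inside_ignores simp: L_def L'_def)
    define P where "P S = of_bool (u \<in> S) * (s ^ edges_inside L S / s ^ g)" for S
    define Q where "Q S = of_bool (v \<in> S) * (s ^ edges_inside L' S / s ^ g)" for S
    have "comonotone P Q"
      unfolding comonotone_def
    proof
      fix x
      have dec: "s ^ edges_inside N (insert x S) / s ^ g \<le> s ^ edges_inside N S / s ^ g" if "finite N" for N :: "'a set set" and S
        using s edges_inside_mono[OF that, of S "insert x S"]
        by (intro divide_right_mono power_decreasing) auto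
      show "(\<forall>S. P S \<le> P (insert x S) \<and> Q S \<le> Q (insert x S))
          \<or> (\<forall>S. P (insert x S) \<le> P S \<and> Q (insert x S) \<le> Q S)"
      proof (cases "x \<in> {u, v}")
        case True
        then show ?thesis
          using ign[of x] s by (intro disjI1) (auto simp: P_def Q_def of_bool_def)
      next
        case False
        then show ?thesis
          using dec[OF L(1)] dec[OF L(2)] by (intro disjI2) (auto simp: P_def Q_def of_bool_def)
      qed
    qed
    moreover have "?drop M k S \<le> P S" for S
      unfolding P_def L_def by (rule matching_drop_le[OF M(1) u(1,2) _ s]) simp
    moreover have "?drop M' k S \<le> Q S" for S
      unfolding Q_def L'_def by (rule matching_drop_le[OF M(2) v(1,2) _ s]) simp
    moreover have "subset_mean V p (\<lambda>S. P S * Q S) \<le> ?c"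
    proof -
      have "P S * Q S = of_bool ({u, v} \<subseteq> S) * (1 / s ^ (2 * g) * s ^ edges_inside (L \<union> L') S)" for S
        unfolding P_def Q_def edges_inside_union[OF L(1-3)] power_add mult_2 by simp
      then have "subset_mean V p (\<lambda>S. P S * Q S)
          = subset_mean V p (\<lambda>S. of_bool ({u, v} \<subseteq> S) * (1 / s ^ (2 * g) * s ^ edges_inside (L \<union> L') S))"
        by simp
      also have "\<dots> = p\<^sup>2 * (1 / s ^ (2 * g) * subset_mean V p (\<lambda>S. s ^ edges_inside (L \<union> L') S))"
      proof -
        have "edges_inside (L \<union> L') (insert x S) = edges_inside (L \<union> L') S" if "x \<in> {u, v}" for x S
          unfolding edges_inside_union[OF L(1-3)] using ign[of x S] that by auto
        then have "subset_mean V p (\<lambda>S. of_bool ({u, v} \<subseteq> S) * (1 / s ^ (2 * g) * s ^ edges_inside (L \<union> L') S))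
            = p ^ card {u, v} * subset_mean V p (\<lambda>S. 1 / s ^ (2 * g) * s ^ edges_inside (L \<union> L') S)"
          using u(3) v(3) by (intro subset_mean_contains V) simp_all
        then show ?thesis
          unfolding subset_mean_cmult using uv by (simp add: card_insert_if power2_eq_square)
      qed
      also have "\<dots> \<le> p\<^sup>2 * (1 / s ^ (2 * g) * ?b ^ card (L \<union> L'))"
      proof (intro mult_left_mono mean_power_edges_inside_le)
        fix e assume "e \<in> L \<union> L'"
        then have "e \<in> M \<or> e \<in> M'" using L(4,5) by blast
        then show "e \<subseteq> V \<and> card e = 2" using M(1,2) unfolding matching_def by metis
      next
        fix x
        have "{e \<in> L \<union> L'. x \<in> e} \<subseteq> {e \<in> M. x \<in> e} \<union> {e \<in> M'. x \<in> e}" using L by auto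
        then have "card {e \<in> L \<union> L'. x \<in> e} \<le> card ({e \<in> M. x \<in> e} \<union> {e \<in> M'. x \<in> e})"
          using fin by (intro card_mono) auto
        also have "\<dots> \<le> card {e \<in> M. x \<in> e} + card {e \<in> M'. x \<in> e}" by (rule card_Un_le)
        also have "\<dots> \<le> 2"
          using matching_card_at[OF M(1), of x] matching_card_at[OF M(2), of x] by simp
        finally show "card {e \<in> L \<union> L'. x \<in> e} \<le> 2" .
      qed (use V s L(1,2) in simp_all)
      also have "\<dots> \<le> p\<^sup>2 * (1 / s ^ (2 * g) * ?b ^ (card M + card M' - 6))"
      proof -
        have T3: "card ?T \<le> 3" using card_insert_le_m1 by (simp add: card_insert_if)
        have "card M \<le> card L + card ?T" "card M' \<le> card L' + card ?T"
          unfolding L_def L'_def by (rule matching_card_away[OF M(1)] matching_card_away[OF M(2)]; simp)+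
        moreover have "card (L \<union> L') = card L + card L'" using L by (intro card_Un_disjoint) auto
        ultimately have "card M + card M' - 6 \<le> card (L \<union> L')" using T3 by linarith
        then show ?thesis using b s by (intro mult_left_mono power_decreasing) auto
      qed
      finally show ?thesis by simp
    qed
    ultimately have "dominated k P Q" unfolding dominated_def by blast
    then show ?thesis by blast
  qed
  then obtain P Q where "\<And>k. k \<in> V \<Longrightarrow> dominated k (P k) (Q k)" by metis
  then have PQ: "\<And>k. k \<in> V \<Longrightarrow> comonotone (P k) (Q k)"
    "\<And>k S. k \<in> V \<Longrightarrow> ?drop M k S \<le> P k S" "\<And>k S. k \<in> V \<Longrightarrow> ?drop M' k S \<le> Q k S"
    "\<And>k. k \<in> V \<Longrightarrow> subset_mean V p (\<lambda>S. P k S * Q k S) \<le> ?c"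
    unfolding dominated_def by blast+
  have "covar V p (?f M) (?f M') \<le> p * (1 - p) * (\<Sum>k\<in>V. subset_mean V p (\<lambda>S. P k S * Q k S))"
    by (intro covar_le_sum_influences V PQ conjI anti fin)
  also have "\<dots> \<le> p * (1 - p) * (real (card V) * ?c)"
    using V PQ(4) by (intro mult_left_mono sum_bounded_above) auto
  finally show ?thesis .
qed

section \<open>Binomial tails\<close>

text \<open>The probability that a binomial variable with \<open>N\<close> trials of success probability \<open>q\<close> is less
  than \<open>g\<close>.\<close>

definition binomial_below :: "nat \<Rightarrow> nat \<Rightarrow> real \<Rightarrow> real" where
  "binomial_below g N q = (\<Sum>k<g. real (N choose k) * q ^ k * (1 - q) ^ (N - k))"

lemma binomial_below_0 [simp]: "binomial_below 0 N q = 0"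
  by (simp add: binomial_below_def)

lemma binomial_below_Suc:
  "binomial_below (Suc g) (Suc N) q
     = q * binomial_below g N q + (1 - q) * binomial_below (Suc g) N q"
proof -
  have rec: "real (Suc N choose k) * q ^ k * (1 - q) ^ (Suc N - k) =
      (1 - q) * (real (N choose k) * q ^ k * (1 - q) ^ (N - k))
      + (if k = 0 then 0 else q * (real (N choose (k - 1)) * q ^ (k - 1) * (1 - q) ^ (N - (k - 1))))"
    for k
  proof (cases k)
    case (Suc j)
    show ?thesis
    proof (cases "k \<le> N")
      case True
      then have "N - j = Suc (N - Suc j)" "Suc N - k = Suc (N - k)" using Suc by auto
      then show ?thesis using Suc by (simp add: algebra_simps)
    next
      case False
      then show ?thesis using Suc by (simp add: algebra_simps)
    qed
  qed simp
  show ?thesis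
    unfolding binomial_below_def rec sum.distrib sum_distrib_left[symmetric]
    by (simp add: sum.lessThan_Suc_shift[of "\<lambda>k. if k = 0 then 0 else _ k"] sum_distrib_left
        del: sum.lessThan_Suc)
qed

text \<open>Disjoint edges lie inside the random set independently of each other, each with probability
  \<open>p\<^sup>2\<close>.\<close>

lemma mean_matching_below:
  assumes V: "finite V" and M: "matching V M"
  shows "subset_mean V p (\<lambda>S. of_bool (edges_inside M S < g)) = binomial_below g (card M) (p\<^sup>2)"
proof -
  have "finite M" using M by (simp add: matching_def)
  then show ?thesis using M
  proof (induction M arbitrary: g rule: finite_induct)
    case empty
    show ?case
      using V by (cases g) (simp_all add: subset_mean_const edges_inside_def binomial_below_def
          sum.lessThan_Suc_shift del: sum.lessThan_Suc)
  next
    case (insert e M)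
    have M: "matching V M" by (rule matching_subset[OF insert.prems]) auto
    have e: "e \<subseteq> V" "card e = 2" using insert.prems by (auto simp: matching_def)
    have fe: "finite e" using e V finite_subset by blast
    have ign: "edges_inside M (insert k S) = edges_inside M S" if "k \<in> e" for k S
    proof (rule edges_inside_ignores)
      fix e' assume e': "e' \<in> M"
      then have "e \<noteq> e'" using insert.hyps by blast
      then have "e \<inter> e' = {}" using insert.prems e' by (simp add: matching_def)
      then show "k \<notin> e'" using that by blast
    qed
    show ?case
    proof (cases g)
      case 0
      then show ?thesis using V by (simp add: subset_mean_const)
    next
      case (Suc h)
      have "subset_mean V p (\<lambda>S. of_bool (edges_inside (insert e M) S < g))
          = subset_mean V p (\<lambda>S. of_bool (edges_inside M S < g)
              + (of_bool (e \<subseteq> S) * of_bool (edges_inside M S < h) - of_bool (e \<subseteq> S) * of_bool (edges_inside M S < g)))"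
        using insert.hyps Suc by (intro subset_mean_cong) (auto simp: edges_inside_insert of_bool_def)
      also have "\<dots> = binomial_below g (card M) (p\<^sup>2)
          + (p\<^sup>2 * binomial_below h (card M) (p\<^sup>2) - p\<^sup>2 * binomial_below g (card M) (p\<^sup>2))"
        using ign e fe insert.IH[OF M]
        by (simp add: subset_mean_add subset_mean_diff subset_mean_contains V)
      also have "\<dots> = binomial_below g (card (insert e M)) (p\<^sup>2)"
        using insert.hyps Suc by (simp add: binomial_below_Suc algebra_simps)
      finally show ?thesis .
    qed
  qed
qed

section \<open>Representations as sums of two elements\<close>

lemma prob_random_subset:
  assumes "0 \<le> p" "p \<le> 1"
  shows "measure_pmf.prob (random_subset n p) X = subset_mean {0..n} p (\<lambda>S. of_bool (S \<in> X))"
proof -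
  let ?R = "\<lambda>V. map_pmf (\<lambda>f. {x \<in> V. f x}) (Pi_pmf V False (\<lambda>_. bernoulli_pmf p))"
  have "measure_pmf.prob (?R V) X = subset_mean V p (\<lambda>S. of_bool (S \<in> X))"
    if "finite V" for V :: "nat set"
    using that
  proof (induction V arbitrary: X rule: finite_induct)
    case empty
    show ?case by (simp add: subset_mean_def indicator_def)
  next
    case (insert k V)
    define h where "h = (\<lambda>y. map_pmf (\<lambda>S. if y then insert k S else S) (?R V))"
    have eq: "{x \<in> insert k V. (f(k := y)) x} = (if y then insert k {x \<in> V. f x} else {x \<in> V. f x})"
      for f y using insert.hyps by auto
    have "?R (insert k V) = bind_pmf (bernoulli_pmf p) h"
      unfolding Pi_pmf_insert'[OF insert.hyps] h_def
      by (simp only: map_pmf_def bind_assoc_pmf bind_return_pmf eq)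
    then have "emeasure (?R (insert k V)) X = emeasure (h True) X * p + emeasure (h False) X * (1 - p)"
      using assms by (simp add: emeasure_bind_pmf)
    also have "\<dots> = ennreal (measure_pmf.prob (h True) X * p + measure_pmf.prob (h False) X * (1 - p))"
      using assms by (simp add: measure_pmf.emeasure_eq_measure ennreal_mult ennreal_plus)
    finally have "measure_pmf.prob (?R (insert k V)) X
        = measure_pmf.prob (h True) X * p + measure_pmf.prob (h False) X * (1 - p)"
      unfolding measure_pmf.emeasure_eq_measure
      using assms by (subst (asm) ennreal_inj) auto
    also have "measure_pmf.prob (h True) X = subset_mean V p (\<lambda>S. of_bool (insert k S \<in> X))"
      unfolding h_def using insert.IH[of "insert k -` X"] by (simp del: map_pmf_comp)
    also have "measure_pmf.prob (h False) X = subset_mean V p (\<lambda>S. of_bool (S \<in> X))"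
      unfolding h_def using insert.IH[of X] by (simp add: map_pmf_def[symmetric] map_pmf_ident)
    finally show ?case
      using insert.hyps by (simp add: subset_mean_insert mult.commute)
  qed
  from this[OF finite_atLeastAtMost] show ?thesis unfolding random_subset_def .
qed

text \<open>The pairs with \<open>a = b\<close> are left out, so that all edges have two vertices and \<open>sum_pairs n j\<close> is a
  matching.\<close>

definition sum_pairs :: "nat \<Rightarrow> nat \<Rightarrow> nat set set" where
  "sum_pairs n j = {{a, b} | a b. a < b \<and> b \<le> n \<and> a + b = j}"

lemma sum_pairs_conv_image: "sum_pairs n j = (\<lambda>a. {a, j - a}) ` {j - n..<(j + 1) div 2}"
proof (intro equalityI subsetI)
  fix e assume "e \<in> sum_pairs n j"
  then obtain a b where "e = {a, b}" "a < b" "b \<le> n" "a + b = j" unfolding sum_pairs_def by blast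
  then show "e \<in> (\<lambda>a. {a, j - a}) ` {j - n..<(j + 1) div 2}"
    by (intro image_eqI[of _ _ a]) auto
next
  fix e assume "e \<in> (\<lambda>a. {a, j - a}) ` {j - n..<(j + 1) div 2}"
  then obtain a where a: "e = {a, j - a}" "j - n \<le> a" "a < (j + 1) div 2" by auto
  then have "a < j - a" "j - a \<le> n" "a + (j - a) = j" by auto
  then show "e \<in> sum_pairs n j" unfolding sum_pairs_def a(1) by blast
qed

lemma card_sum_pairs: "card (sum_pairs n j) = (j + 1) div 2 - (j - n)"
proof -
  have "inj_on (\<lambda>a. {a, j - a}) {j - n..<(j + 1) div 2}"
    by (rule inj_onI) (auto simp: doubleton_eq_iff)
  then show ?thesis unfolding sum_pairs_conv_image by (simp add: card_image)
qed

lemma matching_sum_pairs: "matching {0..n} (sum_pairs n j)"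
  unfolding matching_def
proof (intro conjI ballI impI)
  show "finite (sum_pairs n j)" unfolding sum_pairs_conv_image by simp
next
  fix e e' assume e: "e \<in> sum_pairs n j" "e' \<in> sum_pairs n j" "e \<noteq> e'"
  obtain a b where ab: "e = {a, b}" "a + b = j" using e unfolding sum_pairs_def by blast
  obtain a' b' where ab': "e' = {a', b'}" "a' + b' = j" using e unfolding sum_pairs_def by blast
  show "e \<inter> e' = {}"
  proof (rule ccontr)
    assume "e \<inter> e' \<noteq> {}"
    then have "a = a' \<and> b = b' \<or> a = b' \<and> b = a'" using ab ab' by auto
    then show False using e ab ab' by auto
  qed
qed (auto simp: sum_pairs_def)

lemma sum_pairs_disjoint:
  assumes "i \<noteq> j"
  shows "sum_pairs n i \<inter> sum_pairs n j = {}"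
proof -
  have "(\<Sum>x\<in>e. x) = j" if "e \<in> sum_pairs n j" for e j
    using that unfolding sum_pairs_def by auto
  then show ?thesis using assms by blast
qed

lemma card_two_sum_reps:
  assumes "S \<subseteq> {0..n}"
  shows "card (two_sum_reps S j) = edges_inside (sum_pairs n j) S + of_bool (even j \<and> j div 2 \<in> S)"
proof -
  let ?D = "{(a, b). a \<in> S \<and> b \<in> S \<and> a < b \<and> a + b = j}"
  let ?E = "if even j \<and> j div 2 \<in> S then {(j div 2, j div 2)} else {}"
  have "two_sum_reps S j = ?D \<union> ?E"
    unfolding two_sum_reps_def by (auto simp: le_less)
  moreover have "?D \<inter> ?E = {}" by auto
  moreover have "finite ?D"
    by (rule finite_subset[of _ "{..j} \<times> {..j}"]) auto
  moreover have "card ?D = edges_inside (sum_pairs n j) S"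
    unfolding edges_inside_def
  proof (rule bij_betw_same_card)
    show "bij_betw (\<lambda>(a, b). {a, b}) ?D {e \<in> sum_pairs n j. e \<subseteq> S}"
      unfolding bij_betw_def
    proof
      show "inj_on (\<lambda>(a, b). {a, b}) ?D" by (auto simp: inj_on_def doubleton_eq_iff)
      show "(\<lambda>(a, b). {a, b}) ` ?D = {e \<in> sum_pairs n j. e \<subseteq> S}"
      proof (intro equalityI subsetI)
        fix e assume "e \<in> {e \<in> sum_pairs n j. e \<subseteq> S}"
        then obtain a b where "e = {a, b}" "a < b" "a + b = j" "e \<subseteq> S"
          unfolding sum_pairs_def by blast
        then show "e \<in> (\<lambda>(a, b). {a, b}) ` ?D" by (intro image_eqI[of _ _ "(a, b)"]) auto
      next
        fix e assume "e \<in> (\<lambda>(a, b). {a, b}) ` ?D"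
        then obtain a b where ab: "e = {a, b}" "a \<in> S" "b \<in> S" "a < b" "a + b = j" by auto
        then have "b \<le> n" using assms by auto
        with ab have "e \<in> sum_pairs n j"
          unfolding sum_pairs_def by (intro CollectI exI[of _ a] exI[of _ b] conjI)
        then show "e \<in> {e \<in> sum_pairs n j. e \<subseteq> S}" using ab by simp
      qed
    qed
  qed
  ultimately show ?thesis by (auto simp: card_Un_disjoint)
qed

definition basis_mean :: "nat \<Rightarrow> nat \<Rightarrow> nat set \<Rightarrow> real \<Rightarrow> real" where
  "basis_mean g n J p =
     subset_mean {0..n} p (\<lambda>S. of_bool (\<forall>j\<in>J. g \<le> card (two_sum_reps S j)))"

lemma basis_mean_mono:
  assumes "0 \<le> p" "p \<le> p'" "p' \<le> 1"
  shows "basis_mean g n J p \<le> basis_mean g n J p'"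
proof -
  let ?Q = "\<lambda>S. \<forall>j\<in>J. g \<le> card (two_sum_reps S j)"
  have "card (two_sum_reps S j) \<le> card (two_sum_reps T j)" if "S \<subseteq> T" for S T j
  proof (rule card_mono)
    show "finite (two_sum_reps T j)"
      by (rule finite_subset[of _ "{..j} \<times> {..j}"]) (auto simp: two_sum_reps_def)
  qed (use that in \<open>auto simp: two_sum_reps_def\<close>)
  then have "?Q S \<Longrightarrow> ?Q T" if "S \<subseteq> T" for S T using that by (meson order_trans)
  then have "mono (\<lambda>S. of_bool (?Q S) :: real)" by (intro monoI) (simp add: of_bool_def)
  then show ?thesis
    unfolding basis_mean_def using assms by (intro subset_mean_mono_prob) auto
qed

text \<open>If only representations by distinct elements counted, this would be \<open>mean_all_near_prod\<close> with the
  covariance bound \<open>covar_matchings_below_le\<close>. The representation \<open>j = 2 a\<close> can decide only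
  if \<open>a\<close> is chosen and there are fewer than \<open>g\<close> other representations. These two conditions are independent, whence
  the last summand of the upper bound.\<close>

lemma basis_mean_bounds:
  fixes g n :: nat and J :: "nat set" and p s :: real
  defines "b \<equiv> \<lambda>j. binomial_below g (card (sum_pairs n j)) (p\<^sup>2)"
  assumes p: "0 \<le> p" "p \<le> 1" and s: "0 < s" "s \<le> 1"
    and J: "finite J" "\<And>j. j \<in> J \<Longrightarrow> j \<le> 2 * n" and m: "\<And>j. j \<in> J \<Longrightarrow> m \<le> card (sum_pairs n j)"
  shows "(\<Prod>j\<in>J. 1 - b j) \<le> basis_mean g n J p"
    and "basis_mean g n J p \<le> (\<Prod>j\<in>J. 1 - b j) + (real (card J))\<^sup>2 *
      (p * (1 - p) * (real (n + 1) * (p\<^sup>2 * (1 - (1 - s) * (p * (1 - p))\<^sup>2) ^ (2 * m - 6) / s ^ (2 * g))))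
      + p * (\<Sum>j\<in>J. b j)"
proof -
  let ?V = "{0..n}" and ?m = "subset_mean {0..n} p"
  let ?I = "\<lambda>j. edges_inside (sum_pairs n j)"
  let ?c = "p * (1 - p) * (real (n + 1) * (p\<^sup>2 * (1 - (1 - s) * (p * (1 - p))\<^sup>2) ^ (2 * m - 6) / s ^ (2 * g)))"
  let ?G = "\<lambda>j S. g \<le> ?I j S"
  have fin: "finite (sum_pairs n j)" for j using matching_sum_pairs[of n j] by (simp add: matching_def)
  have b: "?m (\<lambda>S. of_bool (?I j S < g)) = b j" for j
    unfolding b_def by (rule mean_matching_below[OF _ matching_sum_pairs]) simp
  have G: "(\<lambda>S. of_bool (?G j S)) = (\<lambda>S. 1 - of_bool (?I j S < g) :: real)" for j
    by (auto simp: of_bool_def)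
  have mG: "?m (\<lambda>S. of_bool (?G j S)) = 1 - b j" for j
    unfolding G by (simp add: subset_mean_diff subset_mean_const b)
  have upG: "mono (?G j)" for j
    by (intro monoI le_boolI) (erule order_trans[OF _ edges_inside_mono[OF fin]])
  have base: "0 \<le> 1 - (1 - s) * (p * (1 - p))\<^sup>2" "1 - (1 - s) * (p * (1 - p))\<^sup>2 \<le> 1"
    using p s by (intro edge_factor_range; simp)+
  have c0: "0 \<le> ?c" using p s base by simp
  have cov: "covar ?V p (\<lambda>S. of_bool (?G i S)) (\<lambda>S. of_bool (?G j S)) \<le> ?c"
    if "i \<in> J" "j \<in> J" "i \<noteq> j" for i j
  proof -
    have "covar ?V p (\<lambda>S. of_bool (?G i S)) (\<lambda>S. of_bool (?G j S))
        = covar ?V p (\<lambda>S. of_bool (?I i S < g)) (\<lambda>S. of_bool (?I j S < g))"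
      unfolding G by (rule covar_complement) simp
    also have "\<dots> \<le> p * (1 - p) * (real (card ?V) * (p\<^sup>2 * (1 - (1 - s) * (p * (1 - p))\<^sup>2)
        ^ (card (sum_pairs n i) + card (sum_pairs n j) - 6) / s ^ (2 * g)))"
      using p s that
      by (intro covar_matchings_below_le matching_sum_pairs sum_pairs_disjoint) auto
    also have "real (card ?V) = real (n + 1)" by simp
    also have "p * (1 - p) * (real (n + 1) * (p\<^sup>2 * (1 - (1 - s) * (p * (1 - p))\<^sup>2)
        ^ (card (sum_pairs n i) + card (sum_pairs n j) - 6) / s ^ (2 * g))) \<le> ?c"
      using p s base m[OF that(1)] m[OF that(2)]
      by (intro mult_left_mono divide_right_mono power_decreasing) auto
    finally show ?thesis .
  qed
  note strict = mean_all_near_prod[OF _ p J(1) upG cov c0, unfolded mG]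
  have reps: "card (two_sum_reps S j) = ?I j S + of_bool (even j \<and> j div 2 \<in> S)" if "S \<subseteq> ?V" for S j
    using card_two_sum_reps[OF that] .
  have "(\<Prod>j\<in>J. 1 - b j) \<le> ?m (\<lambda>S. of_bool (\<forall>j\<in>J. ?G j S))" by (rule strict(1)) auto
  also have "\<dots> \<le> basis_mean g n J p"
    unfolding basis_mean_def using p reps
    by (intro subset_mean_mono) (auto simp: of_bool_def trans_le_add1)
  finally show "(\<Prod>j\<in>J. 1 - b j) \<le> basis_mean g n J p" .
  let ?H = "\<lambda>j S. of_bool (even j \<and> j div 2 \<in> S) * of_bool (?I j S < g) :: real"
  have "basis_mean g n J p \<le> ?m (\<lambda>S. of_bool (\<forall>j\<in>J. ?G j S) + (\<Sum>j\<in>J. ?H j S))"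
    unfolding basis_mean_def
  proof (intro subset_mean_mono p)
    fix S assume S: "S \<subseteq> ?V"
    have nonneg: "0 \<le> (\<Sum>j\<in>J. ?H j S)" by (intro sum_nonneg) auto
    show "of_bool (\<forall>j\<in>J. g \<le> card (two_sum_reps S j)) \<le> of_bool (\<forall>j\<in>J. ?G j S) + (\<Sum>j\<in>J. ?H j S)"
    proof (cases "(\<forall>j\<in>J. g \<le> card (two_sum_reps S j)) \<and> \<not> (\<forall>j\<in>J. ?G j S)")
      case True
      then obtain j where j: "j \<in> J" "?I j S < g" "g \<le> card (two_sum_reps S j)" by (auto simp: not_le)
      then have "even j \<and> j div 2 \<in> S" using reps[OF S, of j] by (auto split: if_splits simp: of_bool_def)
      then have "?H j S = 1" using j by simp
      moreover have "?H j S \<le> (\<Sum>j\<in>J. ?H j S)" using J j by (intro member_le_sum) auto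
      ultimately show ?thesis using True by simp
    next
      case False
      then show ?thesis using nonneg by (auto simp: of_bool_def)
    qed
  qed
  also have "\<dots> = ?m (\<lambda>S. of_bool (\<forall>j\<in>J. ?G j S)) + (\<Sum>j\<in>J. ?m (?H j))"
    by (simp add: subset_mean_add subset_mean_sum)
  also have "(\<Sum>j\<in>J. ?m (?H j)) \<le> (\<Sum>j\<in>J. p * b j)"
  proof (rule sum_mono)
    fix j assume j: "j \<in> J"
    have b0: "0 \<le> b j"
      using subset_mean_mono[OF p, of ?V "\<lambda>_. 0" "\<lambda>S. of_bool (?I j S < g)"]
      by (simp add: subset_mean_const b)
    show "?m (?H j) \<le> p * b j"
    proof (cases "even j")
      case True
      have "?m (?H j) = ?m (\<lambda>S. of_bool (j div 2 \<in> S) * of_bool (?I j S < g))"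
        using True by (intro subset_mean_cong) simp
      also have "\<dots> = p * ?m (\<lambda>S. of_bool (?I j S < g))"
      proof (rule subset_mean_member)
        show "j div 2 \<in> ?V" using J(2)[OF j] by auto
        show "of_bool (?I j (insert (j div 2) S) < g) = (of_bool (?I j S < g) :: real)" for S
          using True by (subst edges_inside_ignores) (auto simp: sum_pairs_def)
      qed simp
      finally show ?thesis by (simp add: b)
    next
      case False
      then show ?thesis using p b0 by (simp add: subset_mean_const)
    qed
  qed
  also have "(\<Sum>j\<in>J. p * b j) = p * (\<Sum>j\<in>J. b j)" by (simp add: sum_distrib_left)
  finally show "basis_mean g n J p \<le> (\<Prod>j\<in>J. 1 - b j) + (real (card J))\<^sup>2 * ?c + p * (\<Sum>j\<in>J. b j)"
    using strict(2) by fastforce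
qed

section \<open>Asymptotics of single binomial terms\<close>

text \<open>To leading order this is the expected number of representations of an integer next to \<open>\<alpha> n\<close>: such
  an integer has about \<open>\<alpha> n / 2\<close> pairs, each chosen with probability \<open>pair_prob\<close>.\<close>

definition log_scale :: "real \<Rightarrow> nat \<Rightarrow> real \<Rightarrow> nat \<Rightarrow> real" where
  "log_scale \<alpha> g K n = ln (real n) + (real g - 2) * ln (ln (real n)) + \<alpha> * K / 2"

definition pair_prob :: "real \<Rightarrow> nat \<Rightarrow> real \<Rightarrow> nat \<Rightarrow> real" where
  "pair_prob \<alpha> g K n = threshold_radicand \<alpha> g (\<lambda>_. K) n"

lemma pair_prob_eq:
  assumes "0 < \<alpha>"
  shows "pair_prob \<alpha> g K n = 2 / \<alpha> * log_scale \<alpha> g K n / real n"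
proof -
  have "2 / \<alpha> * log_scale \<alpha> g K n
      = 2 / \<alpha> * ln (real n) + (real g - 2) * (2 / \<alpha>) * ln (ln (real n)) + K"
    using assms by (simp add: log_scale_def field_simps)
  then show ?thesis by (simp add: pair_prob_def threshold_radicand_def)
qed

lemma log_scale_tendsto: "(\<lambda>n. log_scale \<alpha> g K n / ln (real n)) \<longlonglongrightarrow> 1"
proof -
  have "(\<lambda>n. 1 + (real g - 2) * (ln (ln (real n)) / ln (real n)) + \<alpha> * K / 2 * (1 / ln (real n)))
      \<longlonglongrightarrow> 1 + (real g - 2) * 0 + \<alpha> * K / 2 * 0"
    by (intro tendsto_intros; real_asymp)
  moreover have "\<forall>\<^sub>F n in sequentially. 1 + (real g - 2) * (ln (ln (real n)) / ln (real n))
      + \<alpha> * K / 2 * (1 / ln (real n)) = log_scale \<alpha> g K n / ln (real n)"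
    using eventually_gt_at_top[of 1]
    by eventually_elim (simp add: log_scale_def field_simps)
  ultimately show ?thesis by (simp add: tendsto_cong)
qed

lemma log_scale_at_top: "filterlim (log_scale \<alpha> g K) at_top sequentially"
proof -
  have "filterlim (\<lambda>n. log_scale \<alpha> g K n / ln (real n) * ln (real n)) at_top sequentially"
    by (rule filterlim_tendsto_pos_mult_at_top[OF log_scale_tendsto]) (simp, real_asymp)
  moreover have "\<forall>\<^sub>F n in sequentially.
      log_scale \<alpha> g K n / ln (real n) * ln (real n) = log_scale \<alpha> g K n"
    using eventually_gt_at_top[of 1] by eventually_elim simp
  ultimately show ?thesis by (simp cong: filterlim_cong)
qed

lemma exp_log_scale:
  assumes "2 < n"
  shows "exp (log_scale \<alpha> g K n) = real n * ln (real n) powr (real g - 2) * exp (\<alpha> * K / 2)"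
  using assms by (simp add: log_scale_def exp_add powr_def)

lemma mean_degree_tendsto:
  assumes "0 < \<alpha>"
  shows "(\<lambda>n. real n * pair_prob \<alpha> g K n / ln (real n)) \<longlonglongrightarrow> 2 / \<alpha>"
proof -
  have "(\<lambda>n. 2 / \<alpha> * (log_scale \<alpha> g K n / ln (real n))) \<longlonglongrightarrow> 2 / \<alpha> * 1"
    by (intro tendsto_intros log_scale_tendsto)
  moreover have "\<forall>\<^sub>F n in sequentially. 2 / \<alpha> * (log_scale \<alpha> g K n / ln (real n))
      = real n * pair_prob \<alpha> g K n / ln (real n)"
    using eventually_gt_at_top[of 0] by eventually_elim (simp add: pair_prob_eq assms)
  ultimately show ?thesis by (simp add: tendsto_cong)
qed

lemma pair_prob_tendsto_0:
  assumes "0 < \<alpha>"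
  shows "pair_prob \<alpha> g K \<longlonglongrightarrow> 0"
proof -
  have "(\<lambda>n. real n * pair_prob \<alpha> g K n / ln (real n) * (ln (real n) / real n)) \<longlonglongrightarrow> 2 / \<alpha> * 0"
    by (intro tendsto_mult mean_degree_tendsto assms) real_asymp
  moreover have "\<forall>\<^sub>F n in sequentially.
      real n * pair_prob \<alpha> g K n / ln (real n) * (ln (real n) / real n) = pair_prob \<alpha> g K n"
    using eventually_gt_at_top[of 1] by eventually_elim simp
  ultimately show ?thesis by (simp add: tendsto_cong)
qed

lemma mean_degree_square_tendsto_0:
  assumes "0 < \<alpha>"
  shows "(\<lambda>n. real n * (pair_prob \<alpha> g K n)\<^sup>2) \<longlonglongrightarrow> 0"
proof -
  have "(\<lambda>n. (real n * pair_prob \<alpha> g K n / ln (real n))\<^sup>2 * ((ln (real n))\<^sup>2 / real n))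
      \<longlonglongrightarrow> (2 / \<alpha>)\<^sup>2 * 0"
    by (intro tendsto_mult tendsto_power mean_degree_tendsto assms) real_asymp
  moreover have "\<forall>\<^sub>F n in sequentially. (real n * pair_prob \<alpha> g K n / ln (real n))\<^sup>2
      * ((ln (real n))\<^sup>2 / real n) = real n * (pair_prob \<alpha> g K n)\<^sup>2"
    using eventually_gt_at_top[of 1] by eventually_elim (simp add: field_simps power2_eq_square)
  ultimately show ?thesis by (simp add: tendsto_cong)
qed

lemma eventually_pair_prob_pos:
  assumes "0 < \<alpha>"
  shows "\<forall>\<^sub>F n in sequentially. 0 < pair_prob \<alpha> g K n"
proof -
  have "\<forall>\<^sub>F n in sequentially. 0 < log_scale \<alpha> g K n"
    using log_scale_at_top by (simp add: filterlim_at_top_dense)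
  then show ?thesis
    using eventually_gt_at_top[of 0] by eventually_elim (simp add: pair_prob_eq assms)
qed

lemma binomial_over_power_tendsto:
  "(\<lambda>N. real (N choose i) / real N ^ i) \<longlonglongrightarrow> 1 / fact i"
proof -
  have "(\<lambda>N. (\<Prod>j<i. (real N - real j) / real N) / fact i) \<longlonglongrightarrow> (\<Prod>j<i. 1) / fact i"
    by (intro tendsto_divide tendsto_prod tendsto_const; (real_asymp | simp))
  moreover have "(\<Prod>j<i. (real N - real j) / real N) / fact i = real (N choose i) / real N ^ i" for N
    by (simp add: binomial_gbinomial gbinomial_prod_rev prod_dividef atLeast0LessThan)
  ultimately show ?thesis by simp
qed

text \<open>Since \<open>N\<close> is within a constant of \<open>\<alpha> n / 2\<close> and \<open>n * q\<^sup>2\<close> tends to \<open>0\<close>, the term behaves like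
  \<open>L ^ i / i! * exp (- L) / q\<close>, where \<open>L\<close> is \<open>log_scale\<close> and \<open>q = 2 L / (\<alpha> n)\<close>. The coefficient \<open>g - 2\<close> of
  the iterated logarithm in \<open>L\<close> is chosen so that the powers of \<open>ln n\<close> cancel exactly for
  \<open>i = g - 1\<close>; for smaller \<open>i\<close> a negative power is left over.\<close>

lemma near_term_tendsto:
  fixes N :: "nat \<Rightarrow> nat" and \<alpha> K :: real and g :: nat
  defines "q \<equiv> pair_prob \<alpha> g K"
  assumes \<alpha>: "0 < \<alpha>" and N: "\<And>n. \<bar>real (N n) - \<alpha> * real n / 2\<bar> \<le> C" and i: "i < g"
  shows "(\<lambda>n. real (N n choose i) * q n ^ i * (1 - q n) ^ (N n - i) / q n)
    \<longlonglongrightarrow> (if i = g - 1 then \<alpha> / 2 * exp (- \<alpha> * K / 2) / fact (g - 1) else 0)"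
proof -
  let ?L = "log_scale \<alpha> g K"
  have q0: "q \<longlonglongrightarrow> 0" unfolding q_def by (rule pair_prob_tendsto_0[OF \<alpha>])
  have nq: "real n * q n = 2 / \<alpha> * ?L n" if "0 < n" for n
    using that by (simp add: q_def pair_prob_eq[OF \<alpha>])
  have N_over_n: "(\<lambda>n. real (N n) / real n) \<longlonglongrightarrow> \<alpha> / 2"
  proof (rule tendsto_sandwich)
    show "\<forall>\<^sub>F n in sequentially. \<alpha> / 2 - C / real n \<le> real (N n) / real n"
      using eventually_gt_at_top[of 0]
    proof eventually_elim
      case (elim n)
      have "(\<alpha> * real n / 2 - C) / real n \<le> real (N n) / real n"
        using N[of n] by (intro divide_right_mono) auto
      then show ?case using elim by (simp add: diff_divide_distrib)
    qed
    show "\<forall>\<^sub>F n in sequentially. real (N n) / real n \<le> \<alpha> / 2 + C / real n"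
      using eventually_gt_at_top[of 0]
    proof eventually_elim
      case (elim n)
      have "real (N n) / real n \<le> (\<alpha> * real n / 2 + C) / real n"
        using N[of n] by (intro divide_right_mono) auto
      then show ?case using elim by (simp add: add_divide_distrib)
    qed
  qed real_asymp+
  have Ntop: "filterlim N at_top sequentially"
  proof -
    have "filterlim (\<lambda>n. real (N n) / real n * real n) at_top sequentially"
      using \<alpha> by (intro filterlim_tendsto_pos_mult_at_top[OF N_over_n] filterlim_real_sequentially) auto
    moreover have "\<forall>\<^sub>F n in sequentially. real (N n) / real n * real n = real (N n)"
      using eventually_gt_at_top[of 0] by eventually_elim simp
    ultimately have "filterlim (\<lambda>n. real (N n)) at_top sequentially" by (simp cong: filterlim_cong)
    then show ?thesis by (simp add: filterlim_sequentially_iff_filterlim_real)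
  qed
  have choose: "(\<lambda>n. real (N n choose i) / real (N n) ^ i) \<longlonglongrightarrow> 1 / fact i"
    using filterlim_compose[OF binomial_over_power_tendsto Ntop] .
  have mean: "(\<lambda>n. real (N n) * q n / ln (real n)) \<longlonglongrightarrow> 1"
  proof -
    have "(\<lambda>n. real (N n) / real n * (real n * q n / ln (real n))) \<longlonglongrightarrow> \<alpha> / 2 * (2 / \<alpha>)"
      unfolding q_def by (intro tendsto_mult N_over_n mean_degree_tendsto \<alpha>)
    moreover have "\<forall>\<^sub>F n in sequentially.
        real (N n) / real n * (real n * q n / ln (real n)) = real (N n) * q n / ln (real n)"
      using eventually_gt_at_top[of 1] by eventually_elim simp
    ultimately have "(\<lambda>n. real (N n) * q n / ln (real n)) \<longlonglongrightarrow> \<alpha> / 2 * (2 / \<alpha>)"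
      by (rule Lim_transform_eventually)
    then show ?thesis using \<alpha> by simp
  qed
  have ratio: "(\<lambda>n. ln (real n) / ?L n) \<longlonglongrightarrow> 1"
    using tendsto_inverse[OF log_scale_tendsto[of \<alpha> g K]] by simp
  have expo: "(\<lambda>n. real (N n) * ln (1 - q n) + ?L n) \<longlonglongrightarrow> 0"
  proof (rule tendsto_rabs_zero_cancel, rule tendsto_sandwich[where f = "\<lambda>_. 0"])
    show "(\<lambda>n. \<alpha> * (real n * (q n)\<^sup>2) + 2 * C * (q n)\<^sup>2 + C * \<bar>q n\<bar>) \<longlonglongrightarrow> 0"
    proof -
      have "(\<lambda>n. \<alpha> * (real n * (q n)\<^sup>2) + 2 * C * (q n)\<^sup>2 + C * \<bar>q n\<bar>)
          \<longlonglongrightarrow> \<alpha> * 0 + 2 * C * 0\<^sup>2 + C * \<bar>0\<bar>"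
        using mean_degree_square_tendsto_0[OF \<alpha>, of g K, folded q_def]
        by (intro tendsto_intros q0)
      then show ?thesis by simp
    qed
    have "\<forall>\<^sub>F n in sequentially. \<bar>q n\<bar> < 1 / 2"
      using order_tendstoD(2)[OF tendsto_rabs[OF q0], of "1/2"] by simp
    then show "\<forall>\<^sub>F n in sequentially. \<bar>real (N n) * ln (1 - q n) + ?L n\<bar>
        \<le> \<alpha> * (real n * (q n)\<^sup>2) + 2 * C * (q n)\<^sup>2 + C * \<bar>q n\<bar>"
      using eventually_gt_at_top[of 0]
    proof eventually_elim
      case (elim n)
      have L: "?L n = \<alpha> * real n / 2 * q n" using nq elim \<alpha> by (simp add: field_simps)
      have "\<bar>ln (1 + - q n) - - q n\<bar> \<le> 2 * (- q n)\<^sup>2"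
        using elim by (intro abs_ln_one_plus_x_minus_x_bound) auto
      then have "\<bar>real (N n)\<bar> * \<bar>ln (1 - q n) + q n\<bar> \<le> \<bar>real (N n)\<bar> * (2 * (q n)\<^sup>2)"
        by (intro mult_left_mono) auto
      also have "\<dots> \<le> (\<alpha> * real n / 2 + C) * (2 * (q n)\<^sup>2)"
        using N[of n] by (intro mult_right_mono) auto
      finally have 1: "\<bar>real (N n) * (ln (1 - q n) + q n)\<bar> \<le> (\<alpha> * real n / 2 + C) * (2 * (q n)\<^sup>2)"
        by (simp add: abs_mult)
      have 2: "\<bar>(real (N n) - \<alpha> * real n / 2) * q n\<bar> \<le> C * \<bar>q n\<bar>"
        unfolding abs_mult using N[of n] by (intro mult_right_mono) auto
      have "real (N n) * ln (1 - q n) + ?L n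
          = real (N n) * (ln (1 - q n) + q n) - (real (N n) - \<alpha> * real n / 2) * q n"
        by (simp add: L algebra_simps)
      then have "\<bar>real (N n) * ln (1 - q n) + ?L n\<bar>
          \<le> (\<alpha> * real n / 2 + C) * (2 * (q n)\<^sup>2) + C * \<bar>q n\<bar>"
        using 1 2 by linarith
      then show ?case by (simp add: algebra_simps)
    qed
  qed auto
  have power: "(\<lambda>n. ln (real n) powr (real i + 1 - real g)) \<longlonglongrightarrow> (if i = g - 1 then 1 else 0)"
  proof (cases "i = g - 1")
    case True
    then have e: "real i + 1 - real g = 0" using i by (simp add: of_nat_diff)
    have "(\<lambda>n. ln (real n) powr 0) \<longlonglongrightarrow> 1"
    proof (rule tendsto_eventually)
      show "\<forall>\<^sub>F n in sequentially. ln (real n) powr 0 = 1"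
        using eventually_gt_at_top[of 1] by eventually_elim simp
    qed
    then show ?thesis using True e by simp
  next
    case False
    then have "real i + 1 - real g < 0" using i by linarith
    then have "(\<lambda>n. ln (real n) powr (real i + 1 - real g)) \<longlonglongrightarrow> 0"
      by (intro tendsto_neg_powr filterlim_compose[OF ln_at_top filterlim_real_sequentially])
    then show ?thesis using False by simp
  qed
  let ?R = "\<lambda>n. real (N n choose i) / real (N n) ^ i * (real (N n) * q n / ln (real n)) ^ i
      * exp (real (N n) * ln (1 - q n) + ?L n) / (1 - q n) ^ i
      * (\<alpha> / 2 * exp (- \<alpha> * K / 2)) * (ln (real n) / ?L n) * ln (real n) powr (real i + 1 - real g)"
  have "?R \<longlonglongrightarrow> 1 / fact i * 1 ^ i * exp 0 / (1 - 0) ^ i * (\<alpha> / 2 * exp (- \<alpha> * K / 2)) * 1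
      * (if i = g - 1 then 1 else 0)"
    by (intro tendsto_intros choose mean expo ratio power q0) simp
  moreover have "\<forall>\<^sub>F n in sequentially.
      ?R n = real (N n choose i) * q n ^ i * (1 - q n) ^ (N n - i) / q n"
  proof -
    have "\<forall>\<^sub>F n in sequentially. 0 < ?L n"
      using log_scale_at_top by (simp add: filterlim_at_top_dense)
    moreover have "\<forall>\<^sub>F n in sequentially. i < N n"
      using Ntop[unfolded filterlim_at_top, rule_format, of "Suc i"] by (simp add: Suc_le_eq)
    moreover have "\<forall>\<^sub>F n in sequentially. q n < 1"
      using order_tendstoD(2)[OF q0, of 1] by simp
    moreover have "\<forall>\<^sub>F n in sequentially. 0 < q n"
      unfolding q_def by (rule eventually_pair_prob_pos[OF \<alpha>])
    ultimately show ?thesis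
      using eventually_gt_at_top[of 2]
    proof eventually_elim
      case (elim n)
      let ?x = "ln (real n)"
      have x: "0 < ?x" using elim by simp
      have "exp (real (N n) * ln (1 - q n)) = (1 - q n) ^ N n"
        using elim by (subst exp_of_nat_mult) simp
      also have "\<dots> = (1 - q n) ^ (N n - i) * (1 - q n) ^ i"
        using elim by (simp flip: power_add)
      finally have e1: "exp (real (N n) * ln (1 - q n) + ?L n) / (1 - q n) ^ i
          = (1 - q n) ^ (N n - i) * (real n * ?x powr (real g - 2) * exp (\<alpha> * K / 2))"
        using elim by (simp add: exp_add exp_log_scale)
      have "?x powr (real g - 2) * ?x powr (real i + 1 - real g) = ?x powr (real i - 1)"
        by (simp flip: powr_add)
      also have "\<dots> = ?x ^ i / ?x" using x by (simp add: powr_diff powr_realpow)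
      finally have e2: "?x powr (real g - 2) * ?x powr (real i + 1 - real g) = ?x ^ i / ?x" .
      have e3: "exp (\<alpha> * K / 2) * exp (- \<alpha> * K / 2) = 1" by (simp flip: exp_add)
      have e4: "\<alpha> / 2 * real n / ?L n = 1 / q n"
        using elim \<alpha> by (simp add: q_def pair_prob_eq)
      have "?R n = real (N n choose i) * q n ^ i / ?x ^ i * (1 - q n) ^ (N n - i)
          * (exp (\<alpha> * K / 2) * exp (- \<alpha> * K / 2))
          * (?x powr (real g - 2) * ?x powr (real i + 1 - real g)) * ?x * (\<alpha> / 2 * real n / ?L n)"
        unfolding e1[unfolded times_divide_eq_right[symmetric]] mult.assoc times_divide_eq_right[symmetric]
        using elim by (simp add: power_mult_distrib power_divide e1 field_simps)
      also have "\<dots> = real (N n choose i) * q n ^ i * (1 - q n) ^ (N n - i) / q n"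
        unfolding e2 e3 e4 using x by simp
      finally show ?case .
    qed
  qed
  ultimately have "(\<lambda>n. real (N n choose i) * q n ^ i * (1 - q n) ^ (N n - i) / q n)
    \<longlonglongrightarrow> 1 / fact i * 1 ^ i * exp 0 / (1 - 0) ^ i * (\<alpha> / 2 * exp (- \<alpha> * K / 2)) * 1
      * (if i = g - 1 then 1 else 0)"
    by (rule Lim_transform_eventually)
  then show ?thesis by (auto simp: mult_ac)
qed

text \<open>With at least \<open>n / 2\<close> pairs the term is, up to a constant factor, at most a power of \<open>y = n * q\<close> times \<open>n * exp (- y / 2)\<close>.
  As \<open>y\<close> is asymptotic to \<open>(2 / \<alpha>) * ln n\<close> and \<open>\<alpha> < 1\<close>, the exponential beats the factor \<open>n\<close>.\<close>

lemma far_term_tendsto_0: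
  fixes N :: "nat \<Rightarrow> nat" and \<alpha> K :: real and g :: nat
  defines "q \<equiv> pair_prob \<alpha> g K"
  assumes \<alpha>: "0 < \<alpha>" "\<alpha> < 1" and N: "\<And>n. n \<le> 2 * N n" "\<And>n. N n \<le> n + 1"
  shows "(\<lambda>n. real (N n choose i) * q n ^ i * (1 - q n) ^ (N n - i) / q n) \<longlonglongrightarrow> 0"
proof -
  define y where "y n = real n * q n" for n
  \<comment> \<open>Any constant strictly between \<open>1\<close> and \<open>1 / \<alpha>\<close> would do: it gives \<open>ln n \<le> y n / (2 * c)\<close>
     eventually, and \<open>\<eta>\<close> is the part of the exponent that is left after cancelling the factor \<open>n\<close>.\<close>
  define c where "c = (1 + 1 / \<alpha>) / 2"
  define \<eta> where "\<eta> = 1 / 2 - 1 / (2 * c)"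
  have c: "1 < c" "2 * c < 2 / \<alpha>" using \<alpha> by (auto simp: c_def field_simps)
  have \<eta>: "0 < \<eta>" using c by (simp add: \<eta>_def field_simps)
  have q0: "q \<longlonglongrightarrow> 0" unfolding q_def by (rule pair_prob_tendsto_0[OF \<alpha>(1)])
  have y_top: "filterlim y at_top sequentially"
  proof -
    have "filterlim (\<lambda>n. 2 / \<alpha> * log_scale \<alpha> g K n) at_top sequentially"
      using \<alpha> by (intro filterlim_tendsto_pos_mult_at_top[OF tendsto_const] log_scale_at_top) auto
    moreover have "\<forall>\<^sub>F n in sequentially. 2 / \<alpha> * log_scale \<alpha> g K n = y n"
      using eventually_gt_at_top[of 0]
      by eventually_elim (simp add: y_def q_def pair_prob_eq[OF \<alpha>(1)])
    ultimately show ?thesis by (simp cong: filterlim_cong)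
  qed
  have "(\<lambda>n. (2 * exp 1 / \<eta>) ^ i * ((\<eta> * y n) ^ i / exp (\<eta> * y n))) \<longlonglongrightarrow> (2 * exp 1 / \<eta>) ^ i * 0"
    by (intro tendsto_mult tendsto_const filterlim_compose[OF tendsto_power_div_exp_0]
        filterlim_tendsto_pos_mult_at_top[OF tendsto_const \<eta>] y_top)
  then have lim: "(\<lambda>n. (2 * exp 1 / \<eta>) ^ i * ((\<eta> * y n) ^ i / exp (\<eta> * y n))) \<longlonglongrightarrow> 0" by simp
  have ev1: "\<forall>\<^sub>F n in sequentially. 2 * c < real n * q n / ln (real n)"
    unfolding q_def by (rule order_tendstoD(1)[OF mean_degree_tendsto[OF \<alpha>(1)] c(2)])
  have ev2: "\<forall>\<^sub>F n in sequentially. 1 < y n" using y_top by (simp add: filterlim_at_top_dense)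
  have ev3: "\<forall>\<^sub>F n in sequentially. q n < 1" using order_tendstoD(2)[OF q0, of 1] by simp
  have ev4: "\<forall>\<^sub>F n in sequentially. 0 < q n"
    unfolding q_def by (rule eventually_pair_prob_pos[OF \<alpha>(1)])
  have bound: "\<forall>\<^sub>F n in sequentially.
    0 \<le> real (N n choose i) * q n ^ i * (1 - q n) ^ (N n - i) / q n \<and>
    real (N n choose i) * q n ^ i * (1 - q n) ^ (N n - i) / q n
      \<le> (2 * exp 1 / \<eta>) ^ i * ((\<eta> * y n) ^ i / exp (\<eta> * y n))"
    using ev1 ev2 ev3 ev4 eventually_gt_at_top[of 1]
  proof eventually_elim
    case (elim n)
    have n: "0 < ln (real n)" using elim by simp
    have "2 * c * ln (real n) \<le> y n" using elim n by (simp add: y_def field_simps)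
    then have "ln (real n) \<le> y n / (2 * c)" using c by (simp add: field_simps)
    then have n_le: "real n \<le> exp (y n / (2 * c))"
      using elim by (metis exp_le_cancel_iff exp_ln of_nat_0_less_iff less_trans zero_less_one)
    have "real (N n choose i) \<le> real (N n ^ i)"
      using binomial_le_pow2[of "N n" i] by (cases "i \<le> N n") (auto intro: binomial_le_pow simp: binomial_eq_0)
    also have "\<dots> \<le> (2 * real n) ^ i"
      unfolding of_nat_power using N(2)[of n] elim by (intro power_mono) auto
    finally have 1: "real (N n choose i) * q n ^ i \<le> (2 * y n) ^ i"
      using elim by (simp add: y_def power_mult_distrib)
    have "(1 - q n) ^ (N n - i) \<le> exp (- q n) ^ (N n - i)"
      using elim exp_ge_add_one_self[of "- q n"] by (intro power_mono) auto
    also have "\<dots> = exp (- q n * real (N n - i))"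
      by (rule exp_of_nat2_mult[symmetric])
    also have "\<dots> \<le> exp (- y n / 2 + real i)"
    proof -
      have "q n * (real n / 2 - real i) \<le> q n * real (N n - i)"
        using N(1)[of n] elim by (intro mult_left_mono) (auto simp: of_nat_diff_if)
      moreover have "q n * real i \<le> real i" using elim by (simp add: mult_left_le_one_le)
      ultimately show ?thesis by (simp add: y_def algebra_simps)
    qed
    also have "\<dots> = exp 1 ^ i * exp (- y n / 2)" 
      using exp_of_nat_mult[of i "1 :: real"] by (simp only: exp_add mult_1_right mult_1_left mult.commute)
    finally have 2: "(1 - q n) ^ (N n - i) \<le> exp 1 ^ i * exp (- y n / 2)" .
    have "1 / q n = real n / y n" using elim by (simp add: y_def)
    also have "\<dots> \<le> real n" using elim by (simp add: field_simps)
    also note n_le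
    finally have 3: "1 / q n \<le> exp (y n / (2 * c))" .
    have "real (N n choose i) * q n ^ i * (1 - q n) ^ (N n - i) * (1 / q n)
        \<le> (2 * y n) ^ i * (exp 1 ^ i * exp (- y n / 2)) * exp (y n / (2 * c))"
      using elim by (intro mult_mono 1 2 3) auto
    also have "\<dots> = (2 * exp 1) ^ i * y n ^ i * exp (- \<eta> * y n)"
      by (simp add: \<eta>_def power_mult_distrib algebra_simps flip: exp_add)
    also have "\<dots> = (2 * exp 1 / \<eta>) ^ i * ((\<eta> * y n) ^ i / exp (\<eta> * y n))"
      using \<eta> by (simp add: power_mult_distrib power_divide exp_minus field_simps)
    finally show ?case using elim by simp
  qed
  show ?thesis
    by (rule tendsto_sandwich[OF _ _ tendsto_const lim]; rule eventually_mono[OF bound]) auto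
qed

section \<open>The expected number of deficient sums\<close>

lemma prod_one_minus_tendsto_exp:
  fixes b :: "nat \<Rightarrow> 'a \<Rightarrow> real"
  assumes fin: "\<And>n. finite (J n)"
    and b: "\<forall>\<^sub>F n in sequentially. \<forall>j\<in>J n. 0 \<le> b n j \<and> b n j \<le> \<beta> n"
    and \<beta>: "\<beta> \<longlonglongrightarrow> 0" and sum: "(\<lambda>n. \<Sum>j\<in>J n. b n j) \<longlonglongrightarrow> l"
  shows "(\<lambda>n. \<Prod>j\<in>J n. 1 - b n j) \<longlonglongrightarrow> exp (- l)"
proof (rule tendsto_sandwich)
  have ev: "\<forall>\<^sub>F n in sequentially. \<beta> n < 1 / 2" using order_tendstoD(2)[OF \<beta>, of "1/2"] by simp
  have "(\<lambda>n. exp (- (1 + 2 * \<beta> n) * (\<Sum>j\<in>J n. b n j))) \<longlonglongrightarrow> exp (- (1 + 2 * 0) * l)"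
    by (intro tendsto_intros \<beta> sum)
  then show "(\<lambda>n. exp (- (1 + 2 * \<beta> n) * (\<Sum>j\<in>J n. b n j))) \<longlonglongrightarrow> exp (- l)" by simp
  show "(\<lambda>n. exp (- (\<Sum>j\<in>J n. b n j))) \<longlonglongrightarrow> exp (- l)"
    by (intro tendsto_intros sum)
  show "\<forall>\<^sub>F n in sequentially. exp (- (1 + 2 * \<beta> n) * (\<Sum>j\<in>J n. b n j)) \<le> (\<Prod>j\<in>J n. 1 - b n j)"
    using b ev
  proof eventually_elim
    case (elim n)
    have "exp (- (1 + 2 * \<beta> n) * (\<Sum>j\<in>J n. b n j)) = (\<Prod>j\<in>J n. exp (- (1 + 2 * \<beta> n) * b n j))"
      by (simp add: sum_distrib_left exp_sum[OF fin])
    also have "\<dots> \<le> (\<Prod>j\<in>J n. 1 - b n j)"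
    proof (intro prod_mono conjI)
      fix j assume "j \<in> J n"
      then have j: "0 \<le> b n j" "b n j \<le> \<beta> n" using elim by auto
      have "b n j * b n j \<le> \<beta> n * b n j" using j by (intro mult_right_mono) auto
      then have "- (1 + 2 * \<beta> n) * b n j \<le> - b n j - 2 * (b n j)\<^sup>2"
        by (simp add: power2_eq_square algebra_simps)
      also have "\<dots> \<le> ln (1 - b n j)" using j elim by (intro ln_one_minus_pos_lower_bound) auto
      finally show "exp (- (1 + 2 * \<beta> n) * b n j) \<le> 1 - b n j"
        using j elim by (subst ln_ge_iff[symmetric]) auto
    qed auto
    finally show ?case .
  qed
  show "\<forall>\<^sub>F n in sequentially. (\<Prod>j\<in>J n. 1 - b n j) \<le> exp (- (\<Sum>j\<in>J n. b n j))"
    using b ev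
  proof eventually_elim
    case (elim n)
    have "(\<Prod>j\<in>J n. 1 - b n j) \<le> (\<Prod>j\<in>J n. exp (- b n j))"
    proof (intro prod_mono conjI)
      fix j assume "j \<in> J n"
      then show "0 \<le> 1 - b n j" using elim by fastforce
      show "1 - b n j \<le> exp (- b n j)" using exp_ge_add_one_self[of "- b n j"] by simp
    qed
    also have "\<dots> = exp (- (\<Sum>j\<in>J n. b n j))" by (simp add: exp_sum[OF fin] flip: sum_negf)
    finally show ?case .
  qed
qed

lemma binomial_below_nonneg: "0 \<le> q \<Longrightarrow> q \<le> 1 \<Longrightarrow> 0 \<le> binomial_below g N q"
  unfolding binomial_below_def by (intro sum_nonneg) auto

lemma binomial_below_antimono:
  assumes "0 \<le> q" "q \<le> 1" "N \<le> N'"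
  shows "binomial_below g N' q \<le> binomial_below g N q"
  using assms(3)
proof (induction N' rule: dec_induct)
  case (step M)
  have "binomial_below g (Suc M) q \<le> binomial_below g M q"
  proof (cases g)
    case (Suc h)
    have "binomial_below h M q \<le> binomial_below g M q"
      unfolding binomial_below_def Suc using assms by simp
    then have "q * binomial_below h M q \<le> q * binomial_below g M q"
      using assms by (intro mult_left_mono)
    then show ?thesis unfolding Suc binomial_below_Suc by (simp add: algebra_simps)
  qed simp
  then show ?case using step.IH by linarith
qed simp

text \<open>By \<open>binomial_tail_sum_diff\<close> this is, up to sign, a discrete antiderivative in the number of trials of
  the probability of fewer than \<open>g\<close> successes, so sums of binomial tails over consecutive numbers of
  trials telescope.\<close>

definition binomial_tail_sum :: "nat \<Rightarrow> real \<Rightarrow> nat \<Rightarrow> real" where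
  "binomial_tail_sum g q N = (\<Sum>k<g. binomial_below (Suc k) N q / q)"

lemma binomial_tail_sum_diff:
  assumes "q \<noteq> 0"
  shows "binomial_tail_sum g q N - binomial_tail_sum g q (Suc N) = binomial_below g N q"
proof -
  have "binomial_tail_sum g q N - binomial_tail_sum g q (Suc N)
      = (\<Sum>k<g. binomial_below (Suc k) N q - binomial_below k N q)"
    unfolding binomial_tail_sum_def sum_subtractf[symmetric]
    using assms by (intro sum.cong refl) (simp add: binomial_below_Suc field_simps)
  also have "\<dots> = binomial_below g N q" by (subst sum_lessThan_telescope) simp
  finally show ?thesis .
qed

text \<open>Among all the terms of the double sum only the one with \<open>k = i = g - 1\<close> survives in the limit.\<close>

lemma binomial_tail_sum_tendsto:
  assumes g: "1 \<le> g"
    and t: "\<And>i. i < g \<Longrightarrow> (\<lambda>n. real (N n choose i) * q n ^ i * (1 - q n) ^ (N n - i) / q n)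
      \<longlonglongrightarrow> (if i = g - 1 then l else 0)"
  shows "(\<lambda>n. binomial_tail_sum g (q n) (N n)) \<longlonglongrightarrow> l"
proof -
  have "(\<lambda>n. \<Sum>k<g. \<Sum>i<Suc k. real (N n choose i) * q n ^ i * (1 - q n) ^ (N n - i) / q n)
      \<longlonglongrightarrow> (\<Sum>k<g. \<Sum>i<Suc k. if i = g - 1 then l else 0)"
    by (intro tendsto_sum t) auto
  also have "(\<Sum>k<g. \<Sum>i<Suc k. if i = g - 1 then l else 0) = (\<Sum>k<g. if k = g - 1 then l else 0)"
  proof (intro sum.cong refl)
    fix k assume "k \<in> {..<g}"
    then have "(g - 1 < Suc k) = (k = g - 1)" by auto
    then show "(\<Sum>i<Suc k. if i = g - 1 then l else 0) = (if k = g - 1 then l else 0)"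
      by (simp del: sum.lessThan_Suc)
  qed
  also have "\<dots> = l" using g by simp
  finally show ?thesis
    by (simp add: binomial_tail_sum_def binomial_below_def sum_divide_distrib del: sum.lessThan_Suc)
qed

definition central_range :: "real \<Rightarrow> nat \<Rightarrow> nat set" where
  "central_range \<alpha> n = {j. \<alpha> * real n \<le> real j \<and> real j \<le> (2 - \<alpha>) * real n}"

lemma central_range_eq:
  assumes "0 < \<alpha>" "\<alpha> < 1"
  shows "nat \<lceil>\<alpha> * real n\<rceil> \<le> n"
    and "central_range \<alpha> n = {nat \<lceil>\<alpha> * real n\<rceil>..2 * n - nat \<lceil>\<alpha> * real n\<rceil>}"
proof -
  let ?m = "nat \<lceil>\<alpha> * real n\<rceil>"
  have "\<alpha> * real n \<le> real n" using assms by (simp add: mult_left_le_one_le)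
  then show m: "?m \<le> n" by (simp add: nat_le_iff ceiling_le_iff)
  have iff: "\<alpha> * real n \<le> real k \<longleftrightarrow> ?m \<le> k" for k by (simp add: nat_le_iff ceiling_le_iff)
  have upper: "real j \<le> (2 - \<alpha>) * real n \<longleftrightarrow> j \<le> 2 * n - ?m" for j
  proof (cases "j \<le> 2 * n")
    case True
    then have "real j \<le> (2 - \<alpha>) * real n \<longleftrightarrow> \<alpha> * real n \<le> real (2 * n - j)"
      by (simp add: of_nat_diff algebra_simps)
    also have "\<dots> \<longleftrightarrow> j \<le> 2 * n - ?m" using True m unfolding iff by linarith
    finally show ?thesis .
  next
    case False
    have "(2 - \<alpha>) * real n \<le> 2 * real n" using assms by (simp add: mult_right_mono)
    also have "\<dots> < real j" using False by simp
    finally show ?thesis using False by auto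
  qed
  show "central_range \<alpha> n = {?m..2 * n - ?m}"
    by (rule set_eqI) (simp only: central_range_def mem_Collect_eq atLeastAtMost_iff iff upper)
qed

lemma card_sum_pairs_min:
  assumes "j \<le> 2 * n"
  shows "card (sum_pairs n j) = (min j (2 * n - j) + 1) div 2"
proof (cases "j \<le> n")
  case True
  then have "min j (2 * n - j) = j" "j - n = 0" by auto
  then show ?thesis by (simp add: card_sum_pairs)
next
  case False
  then obtain d where d: "j = n + d" using le_Suc_ex nat_le_linear by blast
  then obtain e where e: "n = d + e" using assms le_Suc_ex[of d n] by auto
  have "(j + 1) div 2 = d + (e + 1) div 2" unfolding d e by linarith
  then show ?thesis by (simp add: card_sum_pairs d e min_def)
qed

lemma sum_reflect:
  fixes f :: "nat \<Rightarrow> real"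
  assumes "m \<le> n"
  shows "(\<Sum>j = m..2 * n - m. f (min j (2 * n - j))) = 2 * (\<Sum>d = m..n. f d) - f n"
proof -
  have "{m..2 * n - m} = {m..n} \<union> {Suc n..2 * n - m}" using assms by auto
  then have "(\<Sum>j = m..2 * n - m. f (min j (2 * n - j)))
      = (\<Sum>j = m..n. f (min j (2 * n - j))) + (\<Sum>j = Suc n..2 * n - m. f (min j (2 * n - j)))"
    by (simp only:) (intro sum.union_disjoint; auto)
  also have "(\<Sum>j = m..n. f (min j (2 * n - j))) = (\<Sum>d = m..n. f d)"
    by (intro sum.cong refl arg_cong[of _ _ f]) auto
  also have "(\<Sum>j = Suc n..2 * n - m. f (min j (2 * n - j))) = (\<Sum>d = m..<n. f d)"
    using assms
    by (intro sum.reindex_bij_witness[of _ "\<lambda>d. 2 * n - d" "\<lambda>j. 2 * n - j"]) (auto simp: min_def)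
  also have "(\<Sum>d = m..<n. f d) = (\<Sum>d = m..n. f d) - f n"
    using assms by (simp add: sum.last_plus atLeastLessThanSuc_atLeastAtMost[symmetric])
  finally show ?thesis by simp
qed

text \<open>Consecutive values of \<open>(d + 1) div 2\<close> repeat in pairs, so the telescoping function has to be the
  sum of two shifted antiderivatives.\<close>

lemma sum_binomial_below_half:
  assumes "q \<noteq> 0" "m \<le> n"
  shows "(\<Sum>d = m..n. binomial_below g ((d + 1) div 2) q)
    = binomial_tail_sum g q ((m + 1) div 2) + binomial_tail_sum g q ((m + 2) div 2)
      - (binomial_tail_sum g q ((n + 2) div 2) + binomial_tail_sum g q ((n + 3) div 2))"
proof -
  let ?T = "binomial_tail_sum g q"
  define \<psi> where "\<psi> d = ?T ((d + 1) div 2) + ?T ((d + 2) div 2)" for d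
  have "binomial_below g ((d + 1) div 2) q = \<psi> d - \<psi> (Suc d)" for d
  proof -
    have "(d + 3) div 2 = Suc ((d + 1) div 2)" by simp
    then show ?thesis
      using binomial_tail_sum_diff[OF assms(1), of g "(d + 1) div 2"] by (simp add: \<psi>_def numeral_3_eq_3)
  qed
  then have "(\<Sum>d = m..n. binomial_below g ((d + 1) div 2) q) = (\<Sum>d = m..n. \<psi> d - \<psi> (Suc d))" by simp
  also have "\<dots> = \<psi> m - \<psi> (Suc n)"
    using sum_Suc_diff[of m n "\<lambda>d. - \<psi> d"] assms by simp
  finally show ?thesis by (simp add: \<psi>_def numeral_3_eq_3)
qed

lemma half_ceiling_near:
  fixes \<alpha> :: real
  assumes "0 < \<alpha>"
  shows "\<bar>real ((nat \<lceil>\<alpha> * real n\<rceil> + 1) div 2) - \<alpha> * real n / 2\<bar> \<le> 2"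
    and "\<bar>real ((nat \<lceil>\<alpha> * real n\<rceil> + 2) div 2) - \<alpha> * real n / 2\<bar> \<le> 2"
    and "\<bar>real (Suc ((nat \<lceil>\<alpha> * real n\<rceil> + 1) div 2)) - \<alpha> * real n / 2\<bar> \<le> 2"
proof -
  let ?m = "nat \<lceil>\<alpha> * real n\<rceil>"
  have m: "\<alpha> * real n \<le> real ?m" "real ?m \<le> \<alpha> * real n + 1"
    using assms of_int_ceiling_le_add_one[of "\<alpha> * real n"] by (simp_all add: real_nat_ceiling_ge)
  have h: "real k \<le> 2 * real ((k + 1) div 2)" "2 * real ((k + 1) div 2) \<le> real k + 1" for k
    by linarith+
  show "\<bar>real ((?m + 1) div 2) - \<alpha> * real n / 2\<bar> \<le> 2"
    "\<bar>real (Suc ((?m + 1) div 2)) - \<alpha> * real n / 2\<bar> \<le> 2"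
    using m h[of ?m] by (auto simp: abs_le_iff field_simps)
  show "\<bar>real ((?m + 2) div 2) - \<alpha> * real n / 2\<bar> \<le> 2"
    using m h[of "?m + 1"] by (auto simp: abs_le_iff field_simps)
qed

lemma near_tail_sum_tendsto:
  fixes N :: "nat \<Rightarrow> nat" and \<alpha> K :: real
  assumes "0 < \<alpha>" "1 \<le> g" "\<And>n. \<bar>real (N n) - \<alpha> * real n / 2\<bar> \<le> C"
  shows "(\<lambda>n. binomial_tail_sum g (pair_prob \<alpha> g K n) (N n))
    \<longlonglongrightarrow> \<alpha> / 2 * exp (- \<alpha> * K / 2) / fact (g - 1)"
  using assms by (intro binomial_tail_sum_tendsto near_term_tendsto) auto

lemma far_tail_sum_tendsto_0:
  fixes N :: "nat \<Rightarrow> nat" and \<alpha> K :: real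
  assumes "0 < \<alpha>" "\<alpha> < 1" "1 \<le> g" "\<And>n. n \<le> 2 * N n" "\<And>n. N n \<le> n + 1"
  shows "(\<lambda>n. binomial_tail_sum g (pair_prob \<alpha> g K n) (N n)) \<longlonglongrightarrow> 0"
  using assms by (intro binomial_tail_sum_tendsto) (simp_all add: far_term_tendsto_0)

lemma eventually_pair_prob_range:
  assumes "0 < \<alpha>"
  shows "\<forall>\<^sub>F n in sequentially. 0 < pair_prob \<alpha> g K n \<and> pair_prob \<alpha> g K n < 1"
  using eventually_pair_prob_pos[OF assms] order_tendstoD(2)[OF pair_prob_tendsto_0[OF assms], of 1]
  by (simp add: eventually_conj)

lemma card_sum_pairs_central_ge:
  assumes "0 < \<alpha>" "\<alpha> < 1" "j \<in> central_range \<alpha> n"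
  shows "j \<le> 2 * n" "(nat \<lceil>\<alpha> * real n\<rceil> + 1) div 2 \<le> card (sum_pairs n j)"
proof -
  let ?m = "nat \<lceil>\<alpha> * real n\<rceil>"
  have j: "?m \<le> j" "j \<le> 2 * n - ?m" "?m \<le> n"
    using assms(3) central_range_eq(1)[OF assms(1,2), of n]
    unfolding central_range_eq(2)[OF assms(1,2)] atLeastAtMost_iff by blast+
  then show "j \<le> 2 * n" by linarith
  then have "card (sum_pairs n j) = (min j (2 * n - j) + 1) div 2" by (rule card_sum_pairs_min)
  moreover have "?m \<le> min j (2 * n - j)" using j by linarith
  then have "(?m + 1) div 2 \<le> (min j (2 * n - j) + 1) div 2" by (intro div_le_mono add_right_mono)
  ultimately show "(?m + 1) div 2 \<le> card (sum_pairs n j)" by (simp only:)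
qed

text \<open>Folding the range at \<open>n\<close> and telescoping leaves four terms near \<open>\<alpha> n / 2\<close>, two for each end of
  the range, each of which contributes the limit \<open>l\<close>. The terms at the centre of the range are negligible.\<close>

lemma expected_bad_tendsto:
  fixes \<alpha> K :: real
  assumes \<alpha>: "0 < \<alpha>" "\<alpha> < 1" and g: "1 \<le> g"
  shows "(\<lambda>n. \<Sum>j\<in>central_range \<alpha> n. binomial_below g (card (sum_pairs n j)) (pair_prob \<alpha> g K n))
    \<longlonglongrightarrow> 2 * \<alpha> / fact (g - 1) * exp (- K * \<alpha> / 2)"
proof -
  define q where "q = pair_prob \<alpha> g K"
  let ?T = "\<lambda>n. binomial_tail_sum g (q n)"
  let ?m = "\<lambda>n. nat \<lceil>\<alpha> * real n\<rceil>"
  define l where "l = \<alpha> / 2 * exp (- \<alpha> * K / 2) / fact (g - 1)"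
  have near: "(\<lambda>n. ?T n ((?m n + 1) div 2)) \<longlonglongrightarrow> l" "(\<lambda>n. ?T n ((?m n + 2) div 2)) \<longlonglongrightarrow> l"
    unfolding q_def l_def by (intro near_tail_sum_tendsto[where C = 2] half_ceiling_near \<alpha> g)+
  have far: "(\<lambda>n. ?T n ((n + 2) div 2)) \<longlonglongrightarrow> 0" "(\<lambda>n. ?T n ((n + 3) div 2)) \<longlonglongrightarrow> 0"
    "(\<lambda>n. ?T n ((n + 1) div 2)) \<longlonglongrightarrow> 0"
    unfolding q_def by (rule far_tail_sum_tendsto_0[OF \<alpha> g]; linarith)+
  have "(\<lambda>n. 2 * (?T n ((?m n + 1) div 2) + ?T n ((?m n + 2) div 2)
        - (?T n ((n + 2) div 2) + ?T n ((n + 3) div 2)))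
      - (?T n ((n + 1) div 2) - ?T n ((n + 3) div 2))) \<longlonglongrightarrow> 2 * (l + l - (0 + 0)) - (0 - 0)"
    by (intro tendsto_intros near far)
  moreover have "\<forall>\<^sub>F n in sequentially.
      2 * (?T n ((?m n + 1) div 2) + ?T n ((?m n + 2) div 2)
        - (?T n ((n + 2) div 2) + ?T n ((n + 3) div 2)))
      - (?T n ((n + 1) div 2) - ?T n ((n + 3) div 2))
      = (\<Sum>j\<in>central_range \<alpha> n. binomial_below g (card (sum_pairs n j)) (q n))"
    using eventually_pair_prob_range[OF \<alpha>(1), of g K, folded q_def]
  proof eventually_elim
    case (elim n)
    have m: "?m n \<le> n" by (rule central_range_eq[OF \<alpha>])
    have "(n + 3) div 2 = Suc ((n + 1) div 2)" by simp
    then have edge: "?T n ((n + 1) div 2) - ?T n ((n + 3) div 2) = binomial_below g ((n + 1) div 2) (q n)"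
      using elim binomial_tail_sum_diff[of "q n" g "(n + 1) div 2"] by simp
    have "(\<Sum>j\<in>central_range \<alpha> n. binomial_below g (card (sum_pairs n j)) (q n))
        = (\<Sum>j\<in>central_range \<alpha> n. binomial_below g ((min j (2 * n - j) + 1) div 2) (q n))"
      by (intro sum.cong refl) (simp only: card_sum_pairs_min card_sum_pairs_central_ge(1)[OF \<alpha>])
    also have "\<dots> = (\<Sum>j = ?m n..2 * n - ?m n. binomial_below g ((min j (2 * n - j) + 1) div 2) (q n))"
      unfolding central_range_eq(2)[OF \<alpha>] ..
    also have "\<dots> = 2 * (\<Sum>d = ?m n..n. binomial_below g ((d + 1) div 2) (q n))
        - binomial_below g ((n + 1) div 2) (q n)"
      by (rule sum_reflect[OF m])
    finally show ?case
      using elim unfolding edge by (subst (asm) sum_binomial_below_half[OF _ m]) auto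
  qed
  ultimately have "(\<lambda>n. \<Sum>j\<in>central_range \<alpha> n. binomial_below g (card (sum_pairs n j)) (q n))
      \<longlonglongrightarrow> 2 * (l + l - (0 + 0)) - (0 - 0)"
    by (rule Lim_transform_eventually)
  then show ?thesis by (simp add: q_def l_def mult_ac)
qed

lemma max_bad_tendsto_0:
  fixes \<alpha> K :: real
  assumes \<alpha>: "0 < \<alpha>" "\<alpha> < 1" and g: "1 \<le> g"
  shows "(\<lambda>n. binomial_below g ((nat \<lceil>\<alpha> * real n\<rceil> + 1) div 2) (pair_prob \<alpha> g K n)) \<longlonglongrightarrow> 0"
proof -
  let ?q = "pair_prob \<alpha> g K"
  let ?N = "\<lambda>n. (nat \<lceil>\<alpha> * real n\<rceil> + 1) div 2"
  let ?l = "\<alpha> / 2 * exp (- \<alpha> * K / 2) / fact (g - 1)"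
  have "(\<lambda>n. binomial_tail_sum g (?q n) (?N n) - binomial_tail_sum g (?q n) (Suc (?N n))) \<longlonglongrightarrow> ?l - ?l"
    by (intro tendsto_diff near_tail_sum_tendsto[where C = 2] half_ceiling_near \<alpha> g)
  moreover have "\<forall>\<^sub>F n in sequentially. binomial_tail_sum g (?q n) (?N n)
      - binomial_tail_sum g (?q n) (Suc (?N n)) = binomial_below g (?N n) (?q n)"
    using eventually_pair_prob_range[OF \<alpha>(1), of g K]
    by eventually_elim (rule binomial_tail_sum_diff, simp)
  ultimately have "(\<lambda>n. binomial_below g (?N n) (?q n)) \<longlonglongrightarrow> ?l - ?l"
    by (rule Lim_transform_eventually)
  then show ?thesis by simp
qed

section \<open>Convergence of the probability\<close>

text \<open>The error of \<open>basis_mean_bounds\<close> caused by dependence, for \<open>s = 1 / 16\<close>. The exponential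
  factor is about \<open>n\<close> to the power \<open>- 2 * (1 - s) = - 15 / 8\<close>, and the other factors amount to
  \<open>n\<^sup>3 * p\<^sup>3\<close>, which is \<open>n\<close> to the power \<open>3 / 2\<close> up to logarithms. Any \<open>s < 1 / 4\<close> would
  therefore do. The exponent \<open>9 / 5\<close> in the proof lies strictly between \<open>3 / 2\<close> and \<open>15 / 8\<close>.\<close>

lemma dependence_error_tendsto_0:
  fixes \<alpha> K :: real and g :: nat
  assumes \<alpha>: "0 < \<alpha>" "\<alpha> < 1"
  defines "q \<equiv> pair_prob \<alpha> g K"
  defines "E \<equiv> \<lambda>n. (real (card (central_range \<alpha> n)))\<^sup>2 * (sqrt (q n) * (1 - sqrt (q n)) * (real (n + 1) *
      ((sqrt (q n))\<^sup>2 * (1 - (1 - 1 / 16) * (sqrt (q n) * (1 - sqrt (q n)))\<^sup>2)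
        ^ (2 * ((nat \<lceil>\<alpha> * real n\<rceil> + 1) div 2) - 6) / (1 / 16) ^ (2 * g))))"
  shows "E \<longlonglongrightarrow> 0"
proof -
  let ?m = "\<lambda>n. nat \<lceil>\<alpha> * real n\<rceil>"
  let ?k = "\<lambda>n. 2 * ((?m n + 1) div 2) - 6"
  define a where "a = 4 / \<alpha>"
  have a: "0 < a" using \<alpha> by (simp add: a_def)
  have q0: "q \<longlonglongrightarrow> 0" unfolding q_def by (rule pair_prob_tendsto_0[OF \<alpha>(1)])
  have mean: "(\<lambda>n. real n * q n / ln (real n)) \<longlonglongrightarrow> 2 / \<alpha>"
    unfolding q_def by (rule mean_degree_tendsto[OF \<alpha>(1)])
  \<comment> \<open>The exponential factor is at most \<open>n\<close> to the power \<open>- x n\<close>.\<close>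
  define x where "x n = (1 - 1 / 16) * (1 - sqrt (q n))\<^sup>2
    * (\<alpha> * (real n * q n / ln (real n)) - 6 * q n * (1 / ln (real n)))" for n
  have "x \<longlonglongrightarrow> (1 - 1 / 16) * (1 - sqrt 0)\<^sup>2 * (\<alpha> * (2 / \<alpha>) - 6 * 0 * 0)"
    unfolding x_def by (intro tendsto_intros q0 mean) real_asymp
  then have "x \<longlonglongrightarrow> 15 / 8" using \<alpha> by simp
  then have ev1: "\<forall>\<^sub>F n in sequentially. 9 / 5 < x n" by (rule order_tendstoD) simp
  have ev2: "\<forall>\<^sub>F n in sequentially. real n * q n / ln (real n) < a"
    by (rule order_tendstoD(2)[OF mean]) (use \<alpha> in \<open>simp add: a_def field_simps\<close>)
  have ev3: "\<forall>\<^sub>F n in sequentially. 0 < q n \<and> q n < 1"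
    unfolding q_def by (rule eventually_pair_prob_range[OF \<alpha>(1)])
  let ?r = "\<lambda>n. a * ln (real n) / real n"
  let ?B = "\<lambda>n. (2 * real n + 1)\<^sup>2 * ((real n + 1) * (sqrt (?r n) * ?r n * (real n powr (- 9 / 5) * 16 ^ (2 * g))))"
  have bound: "\<forall>\<^sub>F n in sequentially. 0 \<le> E n \<and> E n \<le> ?B n"
    using ev1 ev2 ev3 eventually_gt_at_top[of 1]
  proof eventually_elim
    case (elim n)
    define p where "p = sqrt (q n)"
    have p: "0 < p" "p < 1" "p\<^sup>2 = q n" using elim by (auto simp: p_def)
    define u where "u = (1 - 1 / 16) * (p * (1 - p))\<^sup>2"
    have u: "0 \<le> u" "u \<le> 1" using edge_factor_range[of p "1 / 16"] p by (auto simp: u_def)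
    have n: "0 < ln (real n)" using elim by simp
    have "central_range \<alpha> n \<subseteq> {..2 * n}" using card_sum_pairs_central_ge(1)[OF \<alpha>] by blast
    from card_mono[OF _ this] have card: "real (card (central_range \<alpha> n)) \<le> 2 * real n + 1" by simp
    have q_r: "q n \<le> ?r n" using elim n by (simp add: field_simps)
    then have p_r: "p \<le> sqrt (?r n)" unfolding p_def by (rule real_sqrt_le_mono)
    have "(1 - u) ^ ?k n \<le> exp (- u) ^ ?k n"
      using u exp_ge_add_one_self[of "- u"] by (intro power_mono) auto
    also have "\<dots> = exp (- u * real (?k n))" by (rule exp_of_nat2_mult[symmetric])
    also have "\<dots> \<le> exp (- (9 / 5 * ln (real n)))"
    proof -
      have "\<alpha> * real n \<le> real (?m n)" by (simp add: real_nat_ceiling_ge)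
      moreover have "?m n \<le> ?k n + 6" by linarith
      ultimately have "\<alpha> * real n - 6 \<le> real (?k n)" by linarith
      then have "u * (\<alpha> * real n - 6) \<le> u * real (?k n)" using u by (intro mult_left_mono)
      moreover have "u * (\<alpha> * real n - 6) = x n * ln (real n)"
        using n by (simp add: x_def u_def power_mult_distrib p flip: p_def) (simp add: field_simps)
      moreover have "9 / 5 * ln (real n) \<le> x n * ln (real n)"
        using elim n by (intro mult_right_mono) auto
      ultimately show ?thesis by simp
    qed
    also have "\<dots> = real n powr (- 9 / 5)" using elim by (simp add: powr_def)
    finally have pow: "(1 - u) ^ ?k n \<le> real n powr (- 9 / 5)" .
    have E: "E n = (real (card (central_range \<alpha> n)))\<^sup>2 * ((real n + 1) * (p * (1 - p) * q n * ((1 - u) ^ ?k n * 16 ^ (2 * g))))"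
      unfolding E_def u_def p_def[symmetric] p(3) by (simp add: power_divide mult_ac)
    have "0 \<le> ?r n" using a n elim by simp
    then have r: "0 \<le> sqrt (?r n) * ?r n" by (intro mult_nonneg_nonneg) auto
    have "p * (1 - p) \<le> p" using p by (intro mult_left_le) auto
    then have "p * (1 - p) \<le> sqrt (?r n)" using p_r by linarith
    then have pq: "p * (1 - p) * q n \<le> sqrt (?r n) * ?r n"
      using q_r p elim by (intro mult_mono) auto
    have pow': "(1 - u) ^ ?k n * 16 ^ (2 * g) \<le> real n powr (- 9 / 5) * 16 ^ (2 * g)"
      using pow by (rule mult_right_mono) simp
    have "0 \<le> (1 - u) ^ ?k n * 16 ^ (2 * g)" "0 \<le> p * (1 - p) * q n"
      using u p elim by (intro mult_nonneg_nonneg; simp)+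
    then have "p * (1 - p) * q n * ((1 - u) ^ ?k n * 16 ^ (2 * g))
        \<le> sqrt (?r n) * ?r n * (real n powr (- 9 / 5) * 16 ^ (2 * g))"
      using r by (intro mult_mono pq pow')
    then have le: "(real n + 1) * (p * (1 - p) * q n * ((1 - u) ^ ?k n * 16 ^ (2 * g)))
        \<le> (real n + 1) * (sqrt (?r n) * ?r n * (real n powr (- 9 / 5) * 16 ^ (2 * g)))"
      by (rule mult_left_mono) simp
    have card2: "(real (card (central_range \<alpha> n)))\<^sup>2 \<le> (2 * real n + 1)\<^sup>2"
      using card by (rule power_mono) simp
    have "0 \<le> (real n + 1) * (p * (1 - p) * q n * ((1 - u) ^ ?k n * 16 ^ (2 * g)))"
      using p u elim by (intro mult_nonneg_nonneg) auto
    then have "E n \<le> ?B n"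
      unfolding E by (intro mult_mono[OF card2 le]) simp_all
    moreover have "0 \<le> E n" unfolding E using p u elim by (intro mult_nonneg_nonneg) auto
    ultimately show ?case by simp
  qed
  have "(\<lambda>n. (2 * real n + 1)\<^sup>2 * ((real n + 1) * (sqrt (?r n) * ?r n * real n powr (- 9 / 5)))) \<longlonglongrightarrow> 0"
    using a by real_asymp
  then have "(\<lambda>n. (2 * real n + 1)\<^sup>2 * ((real n + 1) * (sqrt (?r n) * ?r n * real n powr (- 9 / 5)))
      * 16 ^ (2 * g)) \<longlonglongrightarrow> 0 * 16 ^ (2 * g)"
    by (intro tendsto_mult tendsto_const)
  then have lim: "?B \<longlonglongrightarrow> 0" by (simp add: mult_ac)
  show ?thesis
    by (rule tendsto_sandwich[OF _ _ tendsto_const lim]; rule eventually_mono[OF bound]) auto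
qed

lemma basis_mean_tendsto:
  fixes \<alpha> K :: real
  assumes \<alpha>: "0 < \<alpha>" "\<alpha> < 1" and g: "1 \<le> g"
  shows "(\<lambda>n. basis_mean g n (central_range \<alpha> n) (sqrt (pair_prob \<alpha> g K n)))
    \<longlonglongrightarrow> exp (- (2 * \<alpha> / fact (g - 1) * exp (- K * \<alpha> / 2)))"
proof -
  define q where "q = pair_prob \<alpha> g K"
  let ?m = "\<lambda>n. (nat \<lceil>\<alpha> * real n\<rceil> + 1) div 2"
  let ?b = "\<lambda>n j. binomial_below g (card (sum_pairs n j)) (q n)"
  let ?J = "central_range \<alpha>"
  let ?\<Lambda> = "2 * \<alpha> / fact (g - 1) * exp (- K * \<alpha> / 2)"
  let ?P = "\<lambda>n. \<Prod>j\<in>?J n. 1 - ?b n j"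
  let ?E = "\<lambda>n. (real (card (?J n)))\<^sup>2 * (sqrt (q n) * (1 - sqrt (q n)) * (real (n + 1) *
      ((sqrt (q n))\<^sup>2 * (1 - (1 - 1 / 16) * (sqrt (q n) * (1 - sqrt (q n)))\<^sup>2)
        ^ (2 * ?m n - 6) / (1 / 16) ^ (2 * g))))"
  have q0: "q \<longlonglongrightarrow> 0" unfolding q_def by (rule pair_prob_tendsto_0[OF \<alpha>(1)])
  have ev: "\<forall>\<^sub>F n in sequentially. 0 < q n \<and> q n < 1"
    unfolding q_def by (rule eventually_pair_prob_range[OF \<alpha>(1)])
  have fin: "finite (?J n)" for n unfolding central_range_eq(2)[OF \<alpha>] by simp
  have sum: "(\<lambda>n. \<Sum>j\<in>?J n. ?b n j) \<longlonglongrightarrow> ?\<Lambda>"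
    unfolding q_def by (rule expected_bad_tendsto[OF \<alpha> g])
  have prod: "?P \<longlonglongrightarrow> exp (- ?\<Lambda>)"
  proof (rule prod_one_minus_tendsto_exp[OF fin _ _ sum])
    show "(\<lambda>n. binomial_below g (?m n) (q n)) \<longlonglongrightarrow> 0"
      unfolding q_def by (rule max_bad_tendsto_0[OF \<alpha> g])
    show "\<forall>\<^sub>F n in sequentially. \<forall>j\<in>?J n. 0 \<le> ?b n j \<and> ?b n j \<le> binomial_below g (?m n) (q n)"
      using ev
    proof eventually_elim
      case (elim n)
      then show ?case
        using card_sum_pairs_central_ge(2)[OF \<alpha>, of _ n]
        by (intro ballI conjI binomial_below_nonneg binomial_below_antimono) auto
    qed
  qed
  have "?E \<longlonglongrightarrow> 0" unfolding q_def by (rule dependence_error_tendsto_0[OF \<alpha>])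
  then have "(\<lambda>n. ?P n + ?E n + sqrt (q n) * (\<Sum>j\<in>?J n. ?b n j)) \<longlonglongrightarrow> exp (- ?\<Lambda>) + 0 + sqrt 0 * ?\<Lambda>"
    by (intro tendsto_intros prod sum q0)
  then have upper: "(\<lambda>n. ?P n + ?E n + sqrt (q n) * (\<Sum>j\<in>?J n. ?b n j)) \<longlonglongrightarrow> exp (- ?\<Lambda>)" by simp
  have bounds: "\<forall>\<^sub>F n in sequentially.
      ?P n \<le> basis_mean g n (?J n) (sqrt (q n)) \<and>
      basis_mean g n (?J n) (sqrt (q n)) \<le> ?P n + ?E n + sqrt (q n) * (\<Sum>j\<in>?J n. ?b n j)"
    using ev
  proof eventually_elim
    case (elim n)
    then have sq: "(sqrt (q n))\<^sup>2 = q n" "0 \<le> sqrt (q n)" "sqrt (q n) \<le> 1" by auto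
    note * = basis_mean_bounds[OF sq(2,3) _ _ fin card_sum_pairs_central_ge[OF \<alpha>], of "1 / 16" n n g]
    show ?case
      using *(1) *(2) unfolding sq(1) by simp
  qed
  show ?thesis
    unfolding q_def[symmetric]
    by (rule tendsto_sandwich[OF _ _ prod upper]; rule eventually_mono[OF bounds]) auto
qed

text \<open>For constants \<open>K\<close> the limit \<open>F K\<close> is continuous and tends to \<open>0\<close> and \<open>1\<close> as \<open>K\<close> tends to minus
  and plus infinity. Hence comparing \<open>A\<close> with suitable constants gives all three cases.\<close>

theorem theorem1p9:
  fixes \<alpha> :: real and g :: nat and A :: "nat \<Rightarrow> real"
  assumes "0 < \<alpha>" and "\<alpha> < 1" and "g \<ge> 1"
    and "\<forall>\<^sub>F n in sequentially.
           0 \<le> threshold_radicand \<alpha> g A n \<and> threshold_prob \<alpha> g A n \<in> {0..1}"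
  shows "(filterlim A at_bot sequentially \<longrightarrow> basis_prob \<alpha> g A \<longlonglongrightarrow> 0) \<and>
         (filterlim A at_top sequentially \<longrightarrow> basis_prob \<alpha> g A \<longlonglongrightarrow> 1) \<and>
         (\<forall>a::real. A \<longlonglongrightarrow> a \<longrightarrow>
            basis_prob \<alpha> g A \<longlonglongrightarrow> exp (- (2 * \<alpha> / fact (g - 1)) * exp (- a * \<alpha> / 2)))"
proof -
  define F where "F K = exp (- (2 * \<alpha> / fact (g - 1)) * exp (- K * \<alpha> / 2))" for K :: real
  let ?M = "\<lambda>K n. basis_mean g n (central_range \<alpha> n) (sqrt (pair_prob \<alpha> g K n))"
  have M: "?M K \<longlonglongrightarrow> F K" for K
    using basis_mean_tendsto[OF assms(1-3), of K] by (simp add: F_def)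
  have prob: "\<forall>\<^sub>F n in sequentially.
      basis_prob \<alpha> g A n = basis_mean g n (central_range \<alpha> n) (threshold_prob \<alpha> g A n)"
    using assms(4)
  proof eventually_elim
    case (elim n)
    then show ?case
      unfolding basis_prob_def basis_mean_def
      by (subst prob_random_subset)
        (auto intro!: subset_mean_cong simp: truncated_additive_basis_def central_range_def)
  qed
  have radicand: "threshold_radicand \<alpha> g A n \<le> pair_prob \<alpha> g K n \<longleftrightarrow> A n \<le> K"
    "pair_prob \<alpha> g K n \<le> threshold_radicand \<alpha> g A n \<longleftrightarrow> K \<le> A n" if "0 < n" for n K
    using that by (auto simp: pair_prob_def threshold_radicand_def divide_le_cancel)
  have above: "\<forall>\<^sub>F n in sequentially. basis_prob \<alpha> g A n \<le> ?M K n"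
    if "\<forall>\<^sub>F n in sequentially. A n \<le> K" for K
    using that prob assms(4) eventually_pair_prob_range[OF assms(1), of g K] eventually_gt_at_top[of 0]
  proof eventually_elim
    case (elim n)
    have "threshold_prob \<alpha> g A n \<le> sqrt (pair_prob \<alpha> g K n)"
      unfolding threshold_prob_def using elim radicand by (intro real_sqrt_le_mono) auto
    then show ?case using elim by (auto intro!: basis_mean_mono)
  qed
  have below: "\<forall>\<^sub>F n in sequentially. ?M K n \<le> basis_prob \<alpha> g A n"
    if "\<forall>\<^sub>F n in sequentially. K \<le> A n" for K
    using that prob assms(4) eventually_pair_prob_range[OF assms(1), of g K] eventually_gt_at_top[of 0]
  proof eventually_elim
    case (elim n)
    have "sqrt (pair_prob \<alpha> g K n) \<le> threshold_prob \<alpha> g A n"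
      unfolding threshold_prob_def using elim radicand by (intro real_sqrt_le_mono) auto
    then show ?case using elim by (auto intro!: basis_mean_mono)
  qed
  have upper: "\<forall>\<^sub>F n in sequentially. basis_prob \<alpha> g A n < u"
    if "F K < u" "\<forall>\<^sub>F n in sequentially. A n \<le> K" for u K
    using above[OF that(2)] order_tendstoD(2)[OF M that(1)] by eventually_elim linarith
  have lower: "\<forall>\<^sub>F n in sequentially. u < basis_prob \<alpha> g A n"
    if "u < F K" "\<forall>\<^sub>F n in sequentially. K \<le> A n" for u K
    using below[OF that(2)] order_tendstoD(1)[OF M that(1)] by eventually_elim linarith
  define c where "c = 2 * \<alpha> / fact (g - 1)"
  have c: "0 < c" using assms by (simp add: c_def)
  have F: "F = (\<lambda>K. exp (- c * exp (- K * \<alpha> / 2)))" by (simp add: F_def c_def fun_eq_iff)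
  have F_bot: "(F \<longlongrightarrow> 0) at_bot" unfolding F using c assms(1) by real_asymp
  have F_top: "(F \<longlongrightarrow> 1) at_top" unfolding F using c assms(1) by real_asymp
  have "basis_prob \<alpha> g A \<longlonglongrightarrow> 0" if "filterlim A at_bot sequentially"
  proof (rule order_tendstoI)
    fix u :: real assume "0 < u"
    then obtain K where "F K < u"
      using eventually_happens[OF order_tendstoD(2)[OF F_bot, of u]] by auto
    then show "\<forall>\<^sub>F n in sequentially. basis_prob \<alpha> g A n < u"
      by (rule upper) (use that in \<open>simp add: filterlim_at_bot\<close>)
  next
    fix u :: real assume "u < 0"
    then show "\<forall>\<^sub>F n in sequentially. u < basis_prob \<alpha> g A n"
      by (simp add: basis_prob_def less_le_trans[OF _ measure_nonneg])
  qed
  moreover have "basis_prob \<alpha> g A \<longlonglongrightarrow> 1" if "filterlim A at_top sequentially"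
  proof (rule order_tendstoI)
    fix u :: real assume "u < 1"
    then obtain K where "u < F K"
      using eventually_happens[OF order_tendstoD(1)[OF F_top, of u]] by auto
    then show "\<forall>\<^sub>F n in sequentially. u < basis_prob \<alpha> g A n"
      by (rule lower) (use that in \<open>simp add: filterlim_at_top\<close>)
  next
    fix u :: real assume "1 < u"
    then show "\<forall>\<^sub>F n in sequentially. basis_prob \<alpha> g A n < u"
      by (simp add: basis_prob_def le_less_trans[OF measure_pmf.prob_le_1])
  qed
  moreover have "basis_prob \<alpha> g A \<longlonglongrightarrow> F a" if a: "A \<longlonglongrightarrow> a" for a
  proof (rule order_tendstoI)
    have cont: "isCont F a" unfolding F by (intro continuous_intros) simp
    have "(F \<longlongrightarrow> F a) (at_right a)" "(F \<longlongrightarrow> F a) (at_left a)"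
      using cont by (auto simp: isCont_def intro: tendsto_within_subset)
    note F_right = order_tendstoD(2)[OF this(1)] and F_left = order_tendstoD(1)[OF this(2)]
    fix u
    {
      assume "F a < u"
      then have "\<forall>\<^sub>F K in at_right a. F K < u \<and> a < K"
        by (intro eventually_conj F_right eventually_at_right_less)
      then obtain K where "F K < u" "a < K" using eventually_happens by fastforce
      then show "\<forall>\<^sub>F n in sequentially. basis_prob \<alpha> g A n < u"
        by (intro upper[of K] eventually_mono[OF order_tendstoD(2)[OF a] less_imp_le])
    next
      assume "u < F a"
      then have "\<forall>\<^sub>F K in at_left a. u < F K \<and> K < a"
        by (intro eventually_conj F_left) (auto simp: eventually_at_filter)
      then obtain K where "u < F K" "K < a" using eventually_happens by fastforce
      then show "\<forall>\<^sub>F n in sequentially. u < basis_prob \<alpha> g A n"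
        by (intro lower[of _ K] eventually_mono[OF order_tendstoD(1)[OF a] less_imp_le])
    }
  qed
  ultimately show ?thesis unfolding F_def by blast
qed

end
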